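(* Let $\mathcal{A}$ be an essential arrangement of $m$ hyperplanes in $\mathbb{P}^{n-1}$, defined over $\mathbb{R}$, with connected underlying matroid. Then the Hacking–Keel–Tevelev log canonical compactification $S$ of $\mathbb{P}^{n-1}\setminus\mathcal{A}$ is defined by quadrics as a scheme (in its Plücker embedding).
   Context: The arrangement is essential if the common intersection of its hyperplanes in $\mathbb{P}^{n-1}$ is empty; its underlying matroid is the linear matroid of the defining linear forms. Construction of $S$: let $F_1,\ldots,F_m$ be real linear forms defining the hyperplanes of $\mathcal{A}$. The map $F:\mathbb{P}^{n-1}\to\mathbb{P}^{m-1}$, $x\mapsto[F_1(x):\cdots:F_m(x)]$ embeds $\mathbb{P}^{n-1}$ as a linear subspace, giving a point $L$ of the Grassmannian $\mathrm{Gr}(n,m)$ of $(n-1)$-dimensional projective subspaces of $\mathbb{P}^{m-1}$. The torus $(\mathbb{C}^* )^m$ acts on $\mathrm{Gr}(n,m)$ by scaling coordinates of $\mathbb{C}^m$. Let $G_e\subset\mathrm{Gr}(n,m)$ be the sub-Grassmannian of linear spaces containing the vector $e=(1,1,\ldots,1)$. Then $$S:=\overline{(\mathbb{C}^* )^m\cdot L}\,\cap\,G_e,$$ which, by Hacking–Keel–Tevelev, may be taken as the scheme-theoretic intersection. The complement $U=\mathbb{P}^{n-1}\setminus\mathcal{A}$ embeds as an open subvariety of $S$ by $u\mapsto F(u)^{-1}\cdot L$, and $S$ is the log canonical compactification of $U$. $S$ is viewed as a closed subscheme of projective space through the Plücker embedding of $G_e\cong\mathrm{Gr}(n-1,m-1)$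 into $\mathbb{P}^{\binom{m-1}{n-1}-1}$. "Defined by quadrics as a scheme" means that $S$ is the scheme-theoretic intersection of the quadric hypersurfaces containing it, i.e. its homogeneous ideal agrees, up to saturation by the irrelevant ideal, with an ideal generated by quadratic forms. *)

theory Defs
  imports
    "Jordan_Normal_Form.DL_Rank"
    "Jordan_Normal_Form.DL_Submatrix"
    "Jordan_Normal_Form.Matrix_Kernel"
    "HOL-Algebra.Ideal"
    "HOL-Library.Poly_Mapping"
    "HOL-Library.Ramsey"
begin

section \<open>Closed subschemes of complex projective space\<close>

text \<open>
  Polynomials are finitely supported functions on monomials, and monomials are finitely
  supported exponent vectors. The projective space with homogeneous coordinates indexed by a
  finite set \<open>V\<close> is described through its homogeneous coordinate ring \<open>poly_ring V\<close>.
\<close>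

type_synonym 'v cpoly = "('v \<Rightarrow>\<^sub>0 nat) \<Rightarrow>\<^sub>0 complex"

definition poly_ring :: "'v set \<Rightarrow> 'v cpoly ring" where
  "poly_ring V = \<lparr>carrier = {f. \<forall>t\<in>Poly_Mapping.keys f. Poly_Mapping.keys t \<subseteq> V},
     monoid.mult = (*), one = 1, zero = 0, add = (+)\<rparr>"

definition poly_const :: "complex \<Rightarrow> 'v cpoly" where
  "poly_const c = Poly_Mapping.single 0 c"

definition poly_var :: "'v \<Rightarrow> 'v cpoly" where
  "poly_var v = Poly_Mapping.single (Poly_Mapping.single v 1) 1"

text \<open>The coefficients are mapped by \<open>c\<close> and the variables are replaced according to \<open>a\<close>.\<close>

definition poly_subst :: "(complex \<Rightarrow> 'a::comm_semiring_1) \<Rightarrow> ('v \<Rightarrow> 'a) \<Rightarrow> 'v cpoly \<Rightarrow> 'a" where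
  "poly_subst c a f = (\<Sum>t\<in>Poly_Mapping.keys f. c (Poly_Mapping.lookup f t) *
     (\<Prod>v\<in>Poly_Mapping.keys t. a v ^ Poly_Mapping.lookup t v))"

abbreviation poly_eval :: "'v cpoly \<Rightarrow> ('v \<Rightarrow> complex) \<Rightarrow> complex" where
  "poly_eval f x \<equiv> poly_subst (\<lambda>c. c) x f"

definition forms :: "'v set \<Rightarrow> nat \<Rightarrow> 'v cpoly set" where
  "forms V d = {f \<in> carrier (poly_ring V).
     \<forall>t\<in>Poly_Mapping.keys f. (\<Sum>v\<in>Poly_Mapping.keys t. Poly_Mapping.lookup t v) = d}"

text \<open>
  Points are given by their homogeneous coordinate vectors, extended by zero outside \<open>V\<close>. A set
  of points may be given by any set of such representatives; it need not be closed under scaling.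
\<close>

definition projective_points :: "'v set \<Rightarrow> ('v \<Rightarrow> complex) set" where
  "projective_points V = {x. (\<exists>v\<in>V. x v \<noteq> 0) \<and> (\<forall>v. v \<notin> V \<longrightarrow> x v = 0)}"

definition vanishing_forms :: "'v set \<Rightarrow> ('v \<Rightarrow> complex) set \<Rightarrow> 'v cpoly set" where
  "vanishing_forms V X = {f \<in> (\<Union>d. forms V d). \<forall>x\<in>X. poly_eval f x = 0}"

definition zariski_closure :: "'v set \<Rightarrow> ('v \<Rightarrow> complex) set \<Rightarrow> ('v \<Rightarrow> complex) set" where
  "zariski_closure V X =
     {x \<in> projective_points V. \<forall>f\<in>vanishing_forms V X. poly_eval f x = 0}"

definition homogeneous_ideal :: "'v set \<Rightarrow> ('v \<Rightarrow> complex) set \<Rightarrow> 'v cpoly set" where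
  "homogeneous_ideal V X = Idl\<^bsub>poly_ring V\<^esub> (vanishing_forms V X)"

text \<open>
  Saturation by the irrelevant ideal, whose \<open>d\<close>-th power is generated by the forms of degree \<open>d\<close>.
  Two homogeneous ideals define the same closed subscheme iff their saturations agree.
\<close>

definition saturation :: "'v set \<Rightarrow> 'v cpoly set \<Rightarrow> 'v cpoly set" where
  "saturation V I = {f \<in> carrier (poly_ring V). \<exists>d. \<forall>g\<in>forms V d. g * f \<in> I}"

definition defined_by_quadrics :: "'v set \<Rightarrow> 'v cpoly set \<Rightarrow> bool" where
  "defined_by_quadrics V I \<longleftrightarrow>
     (\<exists>Q \<subseteq> forms V 2. saturation V (Idl\<^bsub>poly_ring V\<^esub> Q) = saturation V I)"


section \<open>Hyperplane arrangements and their matroids\<close>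

text \<open>
  Row \<open>i\<close> of the \<open>m \<times> n\<close> matrix \<open>F\<close> holds the coefficients of the linear form defining the
  \<open>i\<close>-th hyperplane.
\<close>

definition arrangement :: "nat \<Rightarrow> nat \<Rightarrow> real mat \<Rightarrow> bool" where
  "arrangement n m F \<longleftrightarrow> n \<ge> 1 \<and> F \<in> carrier_mat m n \<and> (\<forall>i<m. row F i \<noteq> 0\<^sub>v n)"

definition essential :: "nat \<Rightarrow> real mat \<Rightarrow> bool" where
  "essential n F \<longleftrightarrow> mat_kernel (map_mat complex_of_real F) = {0\<^sub>v n}"

text \<open>Linear independence is that of the indexed family, so that equal rows are dependent.\<close>

definition linear_matroid :: "nat \<Rightarrow> nat \<Rightarrow> 'a::field mat \<Rightarrow> nat set \<Rightarrow> bool" where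
  "linear_matroid n m F I \<longleftrightarrow> I \<subseteq> {..<m} \<and>
     (\<forall>c. (\<forall>j<n. (\<Sum>i\<in>I. c i * F $$ (i, j)) = 0) \<longrightarrow> (\<forall>i\<in>I. c i = 0))"

definition circuit :: "'a set \<Rightarrow> ('a set \<Rightarrow> bool) \<Rightarrow> 'a set \<Rightarrow> bool" where
  "circuit E \<I> C \<longleftrightarrow> C \<subseteq> E \<and> \<not> \<I> C \<and> (\<forall>x\<in>C. \<I> (C - {x}))"

definition connected_matroid :: "'a set \<Rightarrow> ('a set \<Rightarrow> bool) \<Rightarrow> bool" where
  "connected_matroid E \<I> \<longleftrightarrow>
     (\<forall>x\<in>E. \<forall>y\<in>E. x \<noteq> y \<longrightarrow> (\<exists>C. circuit E \<I> C \<and> x \<in> C \<and> y \<in> C))"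


section \<open>The log canonical compactification\<close>

text \<open>
  A point of \<open>Gr(n,m)\<close> is the column space of an \<open>m \<times> n\<close> matrix of rank \<open>n\<close>; its Pluecker
  coordinates are the maximal minors, indexed by the \<open>n\<close>-element sets of rows.
\<close>

definition plucker :: "nat \<Rightarrow> nat \<Rightarrow> complex mat \<Rightarrow> nat set \<Rightarrow> complex" where
  "plucker n m A I = (if I \<in> nsets {..<m} n then det (submatrix A I UNIV) else 0)"

definition torus_orbit :: "nat \<Rightarrow> nat \<Rightarrow> complex mat \<Rightarrow> (nat set \<Rightarrow> complex) set" where
  "torus_orbit n m A = {plucker n m (mat_diag m t * A) | t. \<forall>i<m. t i \<noteq> 0}"

text \<open>\<open>G\<^sub>e\<close>, the locus of spaces containing \<open>e = (1,\<dots>,1)\<close>, in Pluecker coordinates of \<open>Gr(n,m)\<close>.\<close>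

definition sub_grassmannian :: "nat \<Rightarrow> nat \<Rightarrow> (nat set \<Rightarrow> complex) set" where
  "sub_grassmannian n m = {plucker n m A | A. A \<in> carrier_mat m n \<and>
     vec_space.rank m A = n \<and> vec m (\<lambda>_. 1) \<in> vec_space.col_space m A}"

text \<open>
  \<open>G\<^sub>e\<close> is identified with \<open>Gr(n-1,m-1)\<close> through \<open>W \<mapsto> W/e\<close>, using the images of the first
  \<open>m-1\<close> unit vectors as a basis of \<open>\<complex>\<^sup>m/e\<close>. If \<open>\<omega>\<close>, with coordinates indexed by the
  \<open>(n-1)\<close>-subsets of \<open>{..<m-1}\<close>, is the Pluecker vector of \<open>W/e\<close>, then that of \<open>W\<close> is
  \<open>e \<and> \<omega>\<close>. The coordinates of \<open>e \<and> \<omega>\<close> are the following linear forms in those of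
  \<open>\<omega>\<close>; terms whose index contains the last element \<open>m-1\<close> are absent. They embed the Pluecker
  space of \<open>Gr(n-1,m-1)\<close> as a linear subspace of that of \<open>Gr(n,m)\<close>.
\<close>

definition wedge_e :: "nat \<Rightarrow> nat set \<Rightarrow> nat set cpoly" where
  "wedge_e m I = (\<Sum>i | i \<in> I \<and> m - 1 \<notin> I - {i}.
     (- 1) ^ card {k \<in> I. k < i} * poly_var (I - {i}))"

text \<open>
  The scheme-theoretic intersection of the torus orbit closure with \<open>G\<^sub>e\<close>, as a subscheme of the
  Pluecker space of \<open>Gr(n,m)\<close>, is given by the sum of the two ideals. It lies in the linear
  subspace above, and its ideal there is obtained by restricting polynomials along \<open>wedge_e\<close>.
\<close>

definition hkt_intersection_ideal :: "nat \<Rightarrow> nat \<Rightarrow> complex mat \<Rightarrow> nat set cpoly set" where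
  "hkt_intersection_ideal n m A = (let V = nsets {..<m} n in
     homogeneous_ideal V (zariski_closure V (torus_orbit n m A))
       <+>\<^bsub>poly_ring V\<^esub> homogeneous_ideal V (sub_grassmannian n m))"

definition hkt_ideal :: "nat \<Rightarrow> nat \<Rightarrow> real mat \<Rightarrow> nat set cpoly set" where
  "hkt_ideal n m F = Idl\<^bsub>poly_ring (nsets {..<m - 1} (n - 1))\<^esub>
     (poly_subst poly_const (wedge_e m) `
        hkt_intersection_ideal n m (map_mat complex_of_real F))"

end

theory Submission
  imports Defs "Jordan_Normal_Form.DL_Rank_Submatrix"
begin

text \<open>
  Two ideals have the same saturation iff they agree after inverting each variable, so the statement
  can be checked in the charts where one Pluecker coordinate \<open>B\<close> is invertible, and separately for
  the forms vanishing on the torus orbit and for those vanishing on \<open>G\<^sub>e\<close>.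

  On the torus orbit this is the theorem of Lason and Michalek that White's conjecture holds up to
  saturation. Splitting a form by torus weights leaves differences of monomials, that is, two multisets
  of bases with the same union. Multiplied by a power of \<open>B\<close>, each of them is changed by
  symmetric exchanges of pairs of bases into a multiset of bases at distance one from \<open>B\<close>, that is,
  into a multigraph on the bipartite exchange graph of \<open>B\<close>; the two multigraphs have equal degrees and
  are related by alternating cycles, of which only the chordless ones need an argument.

  On \<open>G\<^sub>e\<close>, the Pluecker relations express every form in the chart of \<open>B\<close> through the coordinates at \<open>B\<close>
  and its neighbours, which are algebraically independent on a Grassmannian.
\<close>

section \<open>Homogeneous coordinate rings and saturation\<close>

text \<open>The orbit closure lives in the Pluecker space of \<open>Gr(n,m)\<close>, the result in
  that of \<open>Gr(n-1,m-1)\<close>, and their charts have to be matched. A chart of the smaller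
  space belongs to a set \<open>K\<close>. For \<open>B = K \<union> {m - 1}\<close> the coordinate
  of \<open>e \<and> \<omega>\<close> at \<open>B\<close> is that of \<open>\<omega>\<close> at
  \<open>K\<close> up to sign, so inverting \<open>B\<close> in the larger space becomes inverting
  \<open>K\<close> in the smaller one. The substitution \<open>wedge_e\<close> is linear and sends
  quadrics to quadrics; membership in a localized ideal can therefore be checked on generators in
  the larger space.

  Inverting \<open>B\<close> also makes the combinatorics possible. Whether multisets of bases with
  equal union are related by swaps alone is a form of White's conjecture; spare copies of
  \<open>B\<close> turn it into a question on bipartite multigraphs. A chord of an alternating cycle
  yields an intermediate matching, which allows induction. A chordless cycle loses one edge of each
  matching, and what is left of either matching is triangular, so that symmetric exchange has only
  one possible outcome at each step.\<close>

abbreviation polys :: "'v set \<Rightarrow> 'v cpoly set" where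
  "polys V \<equiv> carrier (poly_ring V)"

lemma polys_iff: "f \<in> polys V \<longleftrightarrow> (\<forall>t\<in>Poly_Mapping.keys f. Poly_Mapping.keys t \<subseteq> V)"
  by (simp add: poly_ring_def)

lemma polys_const [simp]: "poly_const c \<in> polys V"
  by (auto simp: polys_iff poly_const_def)

lemma polys_var: "v \<in> V \<Longrightarrow> poly_var v \<in> polys V"
  by (auto simp: polys_iff poly_var_def)

lemma polys_0 [simp]: "0 \<in> polys V" and polys_1 [simp]: "1 \<in> polys V"
  by (auto simp: polys_iff)

lemma polys_add: "f \<in> polys V \<Longrightarrow> g \<in> polys V \<Longrightarrow> f + g \<in> polys V"
  using Poly_Mapping.keys_add[of f g] by (auto simp: polys_iff)

lemma polys_uminus: "f \<in> polys V \<Longrightarrow> - f \<in> polys V"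
  by (auto simp: polys_iff)

lemma polys_diff: "f \<in> polys V \<Longrightarrow> g \<in> polys V \<Longrightarrow> f - g \<in> polys V"
  using polys_add[of f V "- g"] polys_uminus[of g V] by simp

lemma polys_mult: "f \<in> polys V \<Longrightarrow> g \<in> polys V \<Longrightarrow> f * g \<in> polys V"
  using Poly_Mapping.keys_mult[of f g] Poly_Mapping.keys_add unfolding polys_iff
  by (smt (verit, ccfv_threshold) Un_iff mem_Collect_eq subset_iff)

lemma polys_sum: "(\<And>i. i \<in> A \<Longrightarrow> f i \<in> polys V) \<Longrightarrow> sum f A \<in> polys V"
  by (induction A rule: infinite_finite_induct) (auto intro: polys_add)

lemma polys_prod: "(\<And>i. i \<in> A \<Longrightarrow> f i \<in> polys V) \<Longrightarrow> prod f A \<in> polys V"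
  by (induction A rule: infinite_finite_induct) (auto intro: polys_mult)

lemma polys_power: "f \<in> polys V \<Longrightarrow> f ^ k \<in> polys V"
  by (induction k) (auto intro: polys_mult)

lemma polys_mono: "V \<subseteq> W \<Longrightarrow> f \<in> polys V \<Longrightarrow> f \<in> polys W"
  unfolding polys_iff by blast

lemma poly_const_0 [simp]: "poly_const 0 = 0" and poly_const_1 [simp]: "poly_const 1 = 1"
  and poly_const_add: "poly_const (a + b) = poly_const a + poly_const b"
  and poly_const_mult: "poly_const (a * b) = poly_const a * poly_const b"
  by (auto simp: poly_const_def single_add mult_single)

lemma poly_const_uminus: "poly_const (- a) = - poly_const a"
  by (simp add: poly_const_def single_uminus)

lemma poly_const_sum: "poly_const (sum f A) = (\<Sum>i\<in>A. poly_const (f i))"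
  by (induction A rule: infinite_finite_induct) (auto simp: poly_const_add)

lemma poly_const_power: "poly_const (a ^ k) = poly_const a ^ k"
  by (induction k) (auto simp: poly_const_mult)

lemma poly_const_prod: "poly_const (prod f A) = (\<Prod>i\<in>A. poly_const (f i))"
  by (induction A rule: infinite_finite_induct) (auto simp: poly_const_mult)

lemma poly_var_power: "poly_var v ^ k = Poly_Mapping.single (Poly_Mapping.single v k) 1"
  by (induction k) (auto simp: poly_var_def mult_single simp flip: single_add)

lemma poly_mapping_sum_single:
  "f = (\<Sum>t\<in>Poly_Mapping.keys f. Poly_Mapping.single t (Poly_Mapping.lookup f t))"
  by (rule poly_mapping_eqI) (auto simp: lookup_sum lookup_single when_def in_keys_iff)

lemma single_monomial:
  "Poly_Mapping.single t 1 = (\<Prod>v\<in>Poly_Mapping.keys t. poly_var v ^ Poly_Mapping.lookup t v)"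
proof -
  have "Poly_Mapping.single (\<Sum>v\<in>A. Poly_Mapping.single v (h v)) 1 = (\<Prod>v\<in>A. poly_var v ^ h v)"
    if "finite A" for A and h :: "'a \<Rightarrow> nat"
    using that
  proof (induction rule: finite_induct)
    case (insert v A)
    have "Poly_Mapping.single (\<Sum>u\<in>insert v A. Poly_Mapping.single u (h u)) (1::complex)
        = Poly_Mapping.single (Poly_Mapping.single v (h v)) 1 * Poly_Mapping.single (\<Sum>u\<in>A. Poly_Mapping.single u (h u)) 1"
      using insert.hyps by (simp add: mult_single)
    then show ?case using insert by (simp add: poly_var_power)
  qed simp
  from this[of "Poly_Mapping.keys t" "Poly_Mapping.lookup t"] show ?thesis
    by (simp flip: poly_mapping_sum_single)
qed

lemma single_poly_const:
  "Poly_Mapping.single t c = poly_const c * (\<Prod>v\<in>Poly_Mapping.keys t. poly_var v ^ Poly_Mapping.lookup t v)"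
  by (simp add: poly_const_def mult_single flip: single_monomial)

lemma poly_expand:
  "f = (\<Sum>t\<in>Poly_Mapping.keys f. poly_const (Poly_Mapping.lookup f t) *
    (\<Prod>v\<in>Poly_Mapping.keys t. poly_var v ^ Poly_Mapping.lookup t v))"
  unfolding single_poly_const[symmetric] by (rule poly_mapping_sum_single)

text \<open>An expanded polynomial is a sum of products, so a property stable under both operations
  only needs constants and variables. The rule serves several substitution lemmas and
  \<open>pluecker_chart\<close>.\<close>

lemma polys_induct [consumes 1, case_names const var add mult]:
  assumes "f \<in> polys V" and c: "\<And>c. P (poly_const c)" and v: "\<And>v. v \<in> V \<Longrightarrow> P (poly_var v)"
    and a: "\<And>f g. f \<in> polys V \<Longrightarrow> g \<in> polys V \<Longrightarrow> P f \<Longrightarrow> P g \<Longrightarrow> P (f + g)"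
    and m: "\<And>f g. f \<in> polys V \<Longrightarrow> g \<in> polys V \<Longrightarrow> P f \<Longrightarrow> P g \<Longrightarrow> P (f * g)"
  shows "P f"
proof -
  have P0: "P 0" and P1: "P 1" using c[of 0] c[of 1] by simp_all
  let ?Q = "\<lambda>f. f \<in> polys V \<and> P f"
  have sumQ: "?Q (sum h A)" if "\<And>i. i \<in> A \<Longrightarrow> ?Q (h i)" for h :: "_ \<Rightarrow> 'a cpoly" and A
    using that by (induction A rule: infinite_finite_induct) (auto intro: polys_add a P0)
  have prodQ: "?Q (prod h A)" if "\<And>i. i \<in> A \<Longrightarrow> ?Q (h i)" for h :: "'a \<Rightarrow> 'a cpoly" and A
    using that by (induction A rule: infinite_finite_induct) (auto intro: polys_mult m P1)
  have powQ: "?Q (poly_var v ^ k)" if "v \<in> V" for v k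
    by (induction k) (auto intro: polys_mult polys_var m v that P1)
  have "?Q (\<Sum>t\<in>Poly_Mapping.keys f. poly_const (Poly_Mapping.lookup f t) *
    (\<Prod>v\<in>Poly_Mapping.keys t. poly_var v ^ Poly_Mapping.lookup t v))"
  proof (rule sumQ)
    fix t assume "t \<in> Poly_Mapping.keys f"
    then have "?Q (\<Prod>v\<in>Poly_Mapping.keys t. poly_var v ^ Poly_Mapping.lookup t v)"
      using assms(1) by (intro prodQ powQ) (auto simp: polys_iff)
    then show "?Q (poly_const (Poly_Mapping.lookup f t) *
        (\<Prod>v\<in>Poly_Mapping.keys t. poly_var v ^ Poly_Mapping.lookup t v))"
      using c by (auto intro: polys_mult m)
  qed
  then show ?thesis using poly_expand[of f] by simp
qed

text \<open>Evaluation at a point and substitution of polynomials for variables are both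
  \<open>poly_subst\<close>, with \<open>c\<close> the identity or \<open>poly_const\<close>; the
  homomorphism laws are proved once for the two.\<close>

locale coefficient_hom =
  fixes c :: "complex \<Rightarrow> 'a::comm_ring_1"
  assumes c_0: "c 0 = 0" and c_1: "c 1 = 1"
    and c_add: "c (x + y) = c x + c y" and c_mult: "c (x * y) = c x * c y"
begin

lemma subst_add: "poly_subst c a (f + g) = poly_subst c a f + poly_subst c a g"
  unfolding poly_subst_def
  by (rule setsum_keys_plus_distrib[where f = "\<lambda>t x. c x * (\<Prod>v\<in>Poly_Mapping.keys t. a v ^ Poly_Mapping.lookup t v)"])
    (auto simp: c_0 c_add distrib_right)

lemma subst_0 [simp]: "poly_subst c a 0 = 0"
  by (simp add: poly_subst_def)

lemma subst_sum: "poly_subst c a (sum f A) = (\<Sum>i\<in>A. poly_subst c a (f i))"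
  by (induction A rule: infinite_finite_induct) (auto simp: subst_add)

lemma subst_single:
  "poly_subst c a (Poly_Mapping.single t x) = c x * (\<Prod>v\<in>Poly_Mapping.keys t. a v ^ Poly_Mapping.lookup t v)"
  by (simp add: poly_subst_def c_0)

lemma subst_const [simp]: "poly_subst c a (poly_const x) = c x"
  by (simp add: poly_const_def subst_single)

lemma subst_1 [simp]: "poly_subst c a 1 = 1"
  using subst_const[of a 1] by (simp add: c_1)

lemma subst_var [simp]: "poly_subst c a (poly_var v) = a v"
  by (simp add: poly_var_def subst_single c_1)

lemma subst_mult: "poly_subst c a (f * g) = poly_subst c a f * poly_subst c a g"
proof -
  define M where "M t = (\<Prod>v\<in>Poly_Mapping.keys t. a v ^ Poly_Mapping.lookup t v)" for t :: "'b \<Rightarrow>\<^sub>0 nat"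
  \<comment> \<open>Exponents outside the keys are 0, so the product may run over a larger set; this
    lets \<open>s\<close>, \<open>t\<close> and \<open>s + t\<close> share one index set.\<close>
  have M: "M t = (\<Prod>v\<in>A. a v ^ Poly_Mapping.lookup t v)" if "finite A" "Poly_Mapping.keys t \<subseteq> A" for t A
    unfolding M_def using that by (intro prod.mono_neutral_left) (auto simp: in_keys_iff)
  have M_add: "M (s + t) = M s * M t" for s t
  proof -
    let ?A = "Poly_Mapping.keys s \<union> Poly_Mapping.keys t"
    have "M (s + t) = (\<Prod>v\<in>?A. a v ^ Poly_Mapping.lookup (s + t) v)"
      by (rule M) (auto intro!: Poly_Mapping.keys_add)
    also have "\<dots> = M s * M t"
      by (simp add: M[of ?A s] M[of ?A t] lookup_add power_add prod.distrib)
    finally show ?thesis .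
  qed
  let ?k = Poly_Mapping.keys and ?l = Poly_Mapping.lookup
  have "f * g = (\<Sum>s\<in>?k f. Poly_Mapping.single s (?l f s)) * (\<Sum>t\<in>?k g. Poly_Mapping.single t (?l g t))"
    by (simp flip: poly_mapping_sum_single)
  also have "\<dots> = (\<Sum>s\<in>?k f. \<Sum>t\<in>?k g. Poly_Mapping.single (s + t) (?l f s * ?l g t))"
    by (simp add: sum_product mult_single)
  finally have "poly_subst c a (f * g) = (\<Sum>s\<in>?k f. \<Sum>t\<in>?k g. (c (?l f s) * M s) * (c (?l g t) * M t))"
    by (simp add: subst_sum subst_single M_add[unfolded M_def] M_def c_mult ac_simps)
  also have "\<dots> = poly_subst c a f * poly_subst c a g"
    unfolding poly_subst_def M_def sum_product ..
  finally show ?thesis .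
qed

lemma subst_uminus: "poly_subst c a (- f) = - poly_subst c a f"
  using subst_add[of a f "- f"] by (simp add: eq_neg_iff_add_eq_0 add.commute)

lemma subst_diff: "poly_subst c a (f - g) = poly_subst c a f - poly_subst c a g"
  using subst_add[of a f "- g"] by (simp add: subst_uminus)

lemma subst_power: "poly_subst c a (f ^ k) = poly_subst c a f ^ k"
  by (induction k) (auto simp: subst_mult)

lemma subst_prod: "poly_subst c a (prod f A) = (\<Prod>i\<in>A. poly_subst c a (f i))"
  by (induction A rule: infinite_finite_induct) (auto simp: subst_mult)

lemmas subst_simps = subst_add subst_mult subst_uminus subst_diff subst_power subst_sum subst_prod

end

interpretation eval: coefficient_hom "\<lambda>c. c" by standard auto

interpretation subst: coefficient_hom poly_const
  by standard (auto simp: poly_const_add poly_const_mult)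

lemma poly_subst_in_polys:
  "f \<in> polys V \<Longrightarrow> (\<And>v. v \<in> V \<Longrightarrow> a v \<in> polys W) \<Longrightarrow> poly_subst poly_const a f \<in> polys W"
  by (induction rule: polys_induct) (auto simp: subst.subst_simps intro: polys_add polys_mult)

lemma eval_subst:
  "poly_eval (poly_subst poly_const a f) x = poly_eval f (\<lambda>v. poly_eval (a v) x)"
proof -
  have "f \<in> polys UNIV" by (simp add: polys_iff)
  then show ?thesis
    by (induction rule: polys_induct) (auto simp: subst.subst_simps eval.subst_simps)
qed

lemma eval_cong:
  "f \<in> polys V \<Longrightarrow> (\<And>v. v \<in> V \<Longrightarrow> x v = y v) \<Longrightarrow> poly_eval f x = poly_eval f y"
  by (induction rule: polys_induct) (auto simp: eval.subst_simps)

section \<open>Degrees and homogeneous forms\<close>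

abbreviation monom_degree :: "('v \<Rightarrow>\<^sub>0 nat) \<Rightarrow> nat" where
  "monom_degree t \<equiv> \<Sum>v\<in>Poly_Mapping.keys t. Poly_Mapping.lookup t v"

lemma monom_degree_superset:
  "finite A \<Longrightarrow> Poly_Mapping.keys t \<subseteq> A \<Longrightarrow> monom_degree t = (\<Sum>v\<in>A. Poly_Mapping.lookup t v)"
  by (intro sum.mono_neutral_left) (auto simp: in_keys_iff)

lemma monom_degree_add: "monom_degree (s + t) = monom_degree s + monom_degree t"
proof -
  let ?A = "Poly_Mapping.keys s \<union> Poly_Mapping.keys t"
  have "monom_degree (s + t) = (\<Sum>v\<in>?A. Poly_Mapping.lookup (s + t) v)"
    by (intro monom_degree_superset Poly_Mapping.keys_add) auto
  then show ?thesis
    by (simp add: lookup_add sum.distrib monom_degree_superset[of ?A s] monom_degree_superset[of ?A t])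
qed

lemma forms_polys: "f \<in> forms V d \<Longrightarrow> f \<in> polys V"
  by (simp add: forms_def)

lemma forms_iff:
  "f \<in> forms V d \<longleftrightarrow> (\<forall>t\<in>Poly_Mapping.keys f. Poly_Mapping.keys t \<subseteq> V \<and> monom_degree t = d)"
  by (auto simp: forms_def polys_iff)

lemma forms_0 [simp]: "0 \<in> forms V d"
  by (simp add: forms_iff)

lemma forms_const [simp]: "poly_const c \<in> forms V 0"
  by (simp add: forms_iff poly_const_def)

lemma forms_1 [simp]: "1 \<in> forms V 0"
  using forms_const[of 1] by (simp del: forms_const)

lemma forms_var: "v \<in> V \<Longrightarrow> poly_var v \<in> forms V 1"
  by (simp add: forms_iff poly_var_def)

lemma forms_add: "f \<in> forms V d \<Longrightarrow> g \<in> forms V d \<Longrightarrow> f + g \<in> forms V d"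
  using Poly_Mapping.keys_add[of f g] by (auto simp: forms_iff)

lemma forms_uminus: "f \<in> forms V d \<Longrightarrow> - f \<in> forms V d"
  by (auto simp: forms_iff)

lemma forms_diff: "f \<in> forms V d \<Longrightarrow> g \<in> forms V d \<Longrightarrow> f - g \<in> forms V d"
  using forms_add[of f V d "- g"] forms_uminus[of g V d] by simp

lemma forms_sum: "(\<And>i. i \<in> A \<Longrightarrow> f i \<in> forms V d) \<Longrightarrow> sum f A \<in> forms V d"
  by (induction A rule: infinite_finite_induct) (auto intro: forms_add)

lemma forms_mult:
  assumes "f \<in> forms V d" "g \<in> forms V d'" shows "f * g \<in> forms V (d + d')"
  unfolding forms_iff
proof
  fix t assume "t \<in> Poly_Mapping.keys (f * g)"
  then obtain a b where t: "t = a + b" "a \<in> Poly_Mapping.keys f" "b \<in> Poly_Mapping.keys g"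
    using Poly_Mapping.keys_mult[of f g] by blast
  have "Poly_Mapping.keys a \<subseteq> V" "monom_degree a = d" "Poly_Mapping.keys b \<subseteq> V" "monom_degree b = d'"
    using assms t unfolding forms_iff by blast+
  then show "Poly_Mapping.keys t \<subseteq> V \<and> monom_degree t = d + d'"
    using Poly_Mapping.keys_add[of a b] unfolding t(1) monom_degree_add by blast
qed

lemma forms_const_mult: "f \<in> forms V d \<Longrightarrow> poly_const c * f \<in> forms V d"
  using forms_mult[of "poly_const c" V 0 f d] by simp

lemma forms_power: "f \<in> forms V d \<Longrightarrow> f ^ k \<in> forms V (k * d)"
  by (induction k) (auto dest: forms_mult)

lemma forms_prod:
  "(\<And>i. i \<in> A \<Longrightarrow> f i \<in> forms V (d i)) \<Longrightarrow> finite A \<Longrightarrow> prod f A \<in> forms V (sum d A)"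
  by (induction A rule: infinite_finite_induct) (auto intro: forms_mult)

lemma poly_subst_in_forms:
  assumes "f \<in> forms V d" and "\<And>v. v \<in> V \<Longrightarrow> a v \<in> forms W 1"
  shows "poly_subst poly_const a f \<in> forms W d"
  unfolding poly_subst_def
proof (intro forms_sum forms_const_mult)
  fix t assume t: "t \<in> Poly_Mapping.keys f"
  have "(\<Prod>v\<in>Poly_Mapping.keys t. a v ^ Poly_Mapping.lookup t v) \<in> forms W (\<Sum>v\<in>Poly_Mapping.keys t. Poly_Mapping.lookup t v * 1)"
  proof (intro forms_prod forms_power assms(2))
    show "v \<in> V" if "v \<in> Poly_Mapping.keys t" for v
      using that assms(1) t by (auto simp: forms_iff)
  qed auto
  then show "(\<Prod>v\<in>Poly_Mapping.keys t. a v ^ Poly_Mapping.lookup t v) \<in> forms W d"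
    using assms t by (simp add: forms_iff)
qed

section \<open>Ideals of the coordinate ring, localization and saturation\<close>

lemma poly_ring_simps [simp]:
  "f \<oplus>\<^bsub>poly_ring V\<^esub> g = f + g" "f \<otimes>\<^bsub>poly_ring V\<^esub> g = f * g"
  "\<zero>\<^bsub>poly_ring V\<^esub> = 0" "\<one>\<^bsub>poly_ring V\<^esub> = 1"
  by (auto simp: poly_ring_def)

lemma poly_ring_cring: "cring (poly_ring V)"
proof (rule cringI)
  show "abelian_group (poly_ring V)"
  proof (rule abelian_groupI)
    fix f assume "f \<in> carrier (poly_ring V)"
    then show "\<exists>g\<in>carrier (poly_ring V). g \<oplus>\<^bsub>poly_ring V\<^esub> f = \<zero>\<^bsub>poly_ring V\<^esub>"
      by (intro bexI[of _ "- f"]) (auto intro: polys_uminus)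
  next
    fix f g assume "f \<in> carrier (poly_ring V)" "g \<in> carrier (poly_ring V)"
    then show "f \<oplus>\<^bsub>poly_ring V\<^esub> g \<in> carrier (poly_ring V)"
      using polys_add by auto
  qed (auto simp: ac_simps)
  show "comm_monoid (poly_ring V)"
  proof (rule comm_monoidI)
    fix f g assume "f \<in> carrier (poly_ring V)" "g \<in> carrier (poly_ring V)"
    then show "f \<otimes>\<^bsub>poly_ring V\<^esub> g \<in> carrier (poly_ring V)"
      using polys_mult by auto
  qed (auto simp: ac_simps)
qed (auto simp: distrib_right)

text \<open>The ideal axioms in plain arithmetic, equivalent to \<open>ideal\<close> by
  \<open>poly_ideal_iff_ideal\<close>; generated ideals can then be handled without the operations
  of the ring structure.\<close>

definition poly_ideal :: "'v set \<Rightarrow> 'v cpoly set \<Rightarrow> bool" where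
  "poly_ideal V J \<longleftrightarrow> J \<subseteq> polys V \<and> 0 \<in> J \<and> (\<forall>f\<in>J. \<forall>g\<in>J. f + g \<in> J) \<and> (\<forall>f\<in>polys V. \<forall>g\<in>J. f * g \<in> J)"

lemma poly_idealD:
  assumes "poly_ideal V J"
  shows "f \<in> J \<Longrightarrow> f \<in> polys V" "0 \<in> J" "f \<in> J \<Longrightarrow> g \<in> J \<Longrightarrow> f + g \<in> J"
    "f \<in> polys V \<Longrightarrow> g \<in> J \<Longrightarrow> f * g \<in> J"
  using assms by (auto simp: poly_ideal_def)

lemma poly_ideal_uminus: "poly_ideal V J \<Longrightarrow> f \<in> J \<Longrightarrow> - f \<in> J"
  using poly_idealD(4)[of V J "- 1" f] polys_uminus[of 1 V] by simp

lemma poly_ideal_sum: "poly_ideal V J \<Longrightarrow> (\<And>i. i \<in> A \<Longrightarrow> f i \<in> J) \<Longrightarrow> sum f A \<in> J"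
  by (induction A rule: infinite_finite_induct) (auto dest: poly_idealD)

lemma poly_ideal_iff_ideal: "poly_ideal V J \<longleftrightarrow> ideal J (poly_ring V)"
proof
  interpret cring "poly_ring V" by (rule poly_ring_cring)
  assume J: "poly_ideal V J"
  have inv: "\<ominus>\<^bsub>poly_ring V\<^esub> f = - f" if "f \<in> polys V" for f
    using that polys_uminus[OF that] by (intro minus_equality) auto
  show "ideal J (poly_ring V)"
  proof (rule idealI)
    show "subgroup J (add_monoid (poly_ring V))"
    proof (rule subgroup.intro)
      show "inv\<^bsub>add_monoid (poly_ring V)\<^esub> f \<in> J" if "f \<in> J" for f
        using inv[of f] poly_ideal_uminus[OF J that] poly_idealD(1)[OF J that] by (simp add: a_inv_def)
    qed (use poly_idealD[OF J] in auto)
  next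
    fix f g assume "f \<in> J" "g \<in> polys V"
    then show "g \<otimes>\<^bsub>poly_ring V\<^esub> f \<in> J" "f \<otimes>\<^bsub>poly_ring V\<^esub> g \<in> J"
      using poly_idealD(4)[OF J] by (auto simp: mult.commute[of f g])
  qed (rule ring_axioms)
next
  assume "ideal J (poly_ring V)"
  then interpret ideal J "poly_ring V" .
  show "poly_ideal V J"
    unfolding poly_ideal_def
  proof (intro conjI ballI)
    show "0 \<in> J" using additive_subgroup.zero_closed[OF additive_subgroup_axioms] by simp
  next
    fix f g assume "f \<in> J" "g \<in> J"
    then show "f + g \<in> J"
      using additive_subgroup.a_closed[OF additive_subgroup_axioms, of f g] by simp
  next
    fix f g assume "f \<in> polys V" "g \<in> J"
    then show "f * g \<in> J" using I_l_closed[of g f] by simp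
  qed (rule a_subset)
qed

lemma poly_ideal_genideal: "S \<subseteq> polys V \<Longrightarrow> poly_ideal V (Idl\<^bsub>poly_ring V\<^esub> S)"
  using cring.axioms(1)[OF poly_ring_cring] ring.genideal_ideal unfolding poly_ideal_iff_ideal by blast

lemma genideal_self_poly: "S \<subseteq> polys V \<Longrightarrow> f \<in> S \<Longrightarrow> f \<in> Idl\<^bsub>poly_ring V\<^esub> S"
  using cring.axioms(1)[OF poly_ring_cring] ring.genideal_self by blast

lemma genideal_minimal_poly: "poly_ideal V J \<Longrightarrow> S \<subseteq> J \<Longrightarrow> Idl\<^bsub>poly_ring V\<^esub> S \<subseteq> J"
  using cring.axioms(1)[OF poly_ring_cring] ring.genideal_minimal unfolding poly_ideal_iff_ideal by blast

text \<open>Together with \<open>genideal_minimal_poly\<close>, this contraction of an ideal reduces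
  the claim that a substitution sends a whole ideal into \<open>J\<close> to its generators.\<close>

lemma poly_ideal_subst_vimage:
  assumes "poly_ideal W J" "\<And>v. v \<in> V \<Longrightarrow> a v \<in> polys W"
  shows "poly_ideal V {f \<in> polys V. poly_subst poly_const a f \<in> J}"
  using poly_idealD[OF assms(1)] poly_subst_in_polys[where a = a and V = V and W = W] assms(2)
  by (auto simp: poly_ideal_def subst.subst_simps intro: polys_add polys_mult)

lemma poly_ideal_eval: "poly_ideal V {f \<in> polys V. \<forall>x\<in>X. poly_eval f x = 0}"
  by (auto simp: poly_ideal_def eval.subst_simps intro: polys_add polys_mult)

text \<open>For an ideal \<open>J\<close> this is \<open>J : v^\<infinity>\<close>, the contraction
  of its extension to the chart where the variable \<open>v\<close> is a unit.\<close>

definition localization :: "'v set \<Rightarrow> 'v \<Rightarrow> 'v cpoly set \<Rightarrow> 'v cpoly set" where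
  "localization V v J = {f \<in> polys V. \<exists>N. poly_var v ^ N * f \<in> J}"

lemma localization_mono: "J \<subseteq> J' \<Longrightarrow> localization V v J \<subseteq> localization V v J'"
  by (auto simp: localization_def)

lemma subset_localization: "poly_ideal V J \<Longrightarrow> J \<subseteq> localization V v J"
  using poly_idealD(1) by (auto simp: localization_def intro: exI[of _ 0])

lemma poly_ideal_power_mono:
  assumes "poly_ideal V J" "v \<in> V" "poly_var v ^ N * f \<in> J" "N \<le> M"
  shows "poly_var v ^ M * f \<in> J"
  using poly_idealD(4)[OF assms(1) polys_power[OF polys_var[OF assms(2)], of "M - N"] assms(3)] assms(4)
  by (simp flip: mult.assoc power_add)

lemma poly_ideal_localization:
  assumes J: "poly_ideal V J" and v: "v \<in> V"
  shows "poly_ideal V (localization V v J)"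
  unfolding poly_ideal_def
proof (intro conjI ballI)
  fix f g assume "f \<in> localization V v J" "g \<in> localization V v J"
  then obtain N M where f: "f \<in> polys V" "poly_var v ^ N * f \<in> J"
    and g: "g \<in> polys V" "poly_var v ^ M * g \<in> J" by (auto simp: localization_def)
  have "poly_var v ^ (max N M) * (f + g) \<in> J"
    using poly_ideal_power_mono[OF J v f(2)] poly_ideal_power_mono[OF J v g(2)] poly_idealD(3)[OF J]
    by (simp add: distrib_left)
  then show "f + g \<in> localization V v J" using f g by (auto simp: localization_def intro: polys_add)
next
  fix f g assume f: "f \<in> polys V" and "g \<in> localization V v J"
  then obtain N where g: "g \<in> polys V" "poly_var v ^ N * g \<in> J" by (auto simp: localization_def)
  have "poly_var v ^ N * (f * g) \<in> J" using poly_idealD(4)[OF J f g(2)] by (simp add: ac_simps)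
  then show "f * g \<in> localization V v J" using f g by (auto simp: localization_def intro: polys_mult)
qed (use poly_idealD[OF J] in \<open>auto simp: localization_def\<close>)

text \<open>Division by the unit of the chart.\<close>

lemma localization_cancel:
  "f \<in> polys V \<Longrightarrow> poly_var v ^ k * f \<in> localization V v J \<Longrightarrow> f \<in> localization V v J"
  unfolding localization_def by (auto simp: simp flip: mult.assoc power_add)

text \<open>Powers of a variable are forms; conversely, by the pigeonhole principle, forms of large
  degree lie in the ideal generated by given powers of the variables.\<close>

lemma saturation_iff:
  assumes fin: "finite V" and J: "poly_ideal V J"
  shows "f \<in> saturation V J \<longleftrightarrow> f \<in> polys V \<and> (\<forall>v\<in>V. f \<in> localization V v J)"
proof (intro iffI conjI ballI)
  assume f: "f \<in> saturation V J"
  then show fV: "f \<in> polys V" by (simp add: saturation_def)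
  obtain d where d: "\<forall>g\<in>forms V d. g * f \<in> J" using f by (auto simp: saturation_def)
  show "f \<in> localization V v J" if "v \<in> V" for v
    using d fV forms_power[OF forms_var[OF that], of d] by (auto simp: localization_def)
next
  assume f: "f \<in> polys V \<and> (\<forall>v\<in>V. f \<in> localization V v J)"
  then have "\<forall>v\<in>V. \<exists>N. poly_var v ^ N * f \<in> J" by (auto simp: localization_def)
  then obtain N where N: "\<forall>v\<in>V. poly_var v ^ N v * f \<in> J" by metis
  \<comment> \<open>In a monomial whose degree exceeds the sum of the \<open>N v\<close>, some
    \<open>v\<close> has an exponent greater than \<open>N v\<close>.\<close>
  have "\<forall>g\<in>forms V (sum N V + 1). g * f \<in> J"
  proof
    fix g assume g: "g \<in> forms V (sum N V + 1)"
    have "Poly_Mapping.single t (Poly_Mapping.lookup g t) * f \<in> J" if t: "t \<in> Poly_Mapping.keys g" for t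
    proof -
      have tV: "Poly_Mapping.keys t \<subseteq> V" and "monom_degree t = sum N V + 1" using g t by (auto simp: forms_iff)
      then have "sum N V < (\<Sum>v\<in>V. Poly_Mapping.lookup t v)"
        using monom_degree_superset[OF fin, of t] by simp
      then obtain v where v: "v \<in> V" "N v < Poly_Mapping.lookup t v"
        by (meson leI sum_mono leD)
      have vt: "v \<in> Poly_Mapping.keys t" using v by (simp add: in_keys_iff)
      let ?r = "poly_const (Poly_Mapping.lookup g t) *
          (\<Prod>u\<in>Poly_Mapping.keys t - {v}. poly_var u ^ Poly_Mapping.lookup t u)"
      have "Poly_Mapping.single t (Poly_Mapping.lookup g t) * f
          = ?r * (poly_var v ^ Poly_Mapping.lookup t v * f)"
        unfolding single_poly_const using vt by (simp add: prod.remove[of _ v] ac_simps)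
      moreover have "?r \<in> polys V" using tV by (auto intro!: polys_mult polys_prod polys_power polys_var)
      moreover have "poly_var v ^ Poly_Mapping.lookup t v * f \<in> J"
        using poly_ideal_power_mono[OF J v(1)] N v by (metis less_imp_le)
      ultimately show ?thesis using poly_idealD(4)[OF J] by simp
    qed
    then have "(\<Sum>t\<in>Poly_Mapping.keys g. Poly_Mapping.single t (Poly_Mapping.lookup g t) * f) \<in> J"
      by (rule poly_ideal_sum[OF J])
    then show "g * f \<in> J" by (simp flip: sum_distrib_right poly_mapping_sum_single)
  qed
  then show "f \<in> saturation V J" using f unfolding saturation_def by blast
qed

text \<open>Isolating one variable at a time reduces the claim to a univariate polynomial with
  infinitely many roots. The exponents are an arbitrary family \<open>e\<close> because the lemma
  serves both exponent vectors of polynomials and weights of the torus.\<close>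

lemma monomials_independent:
  fixes e :: "'i \<Rightarrow> 'v \<Rightarrow> nat" and c :: "'i \<Rightarrow> complex"
  assumes "finite V" "finite T"
    and "\<And>s t. s \<in> T \<Longrightarrow> t \<in> T \<Longrightarrow> (\<forall>v\<in>V. e s v = e t v) \<Longrightarrow> s = t"
    and "\<And>x. \<forall>v. x v \<noteq> 0 \<Longrightarrow> (\<Sum>t\<in>T. c t * (\<Prod>v\<in>V. x v ^ e t v)) = 0"
    and "t \<in> T"
  shows "c t = 0"
  using assms
proof (induction V arbitrary: T t rule: finite_induct)
  case empty
  then have "T = {t}" by auto
  then show ?case using empty.prems(3)[of "\<lambda>_. 1"] by simp
next
  case (insert v V)
  define T' where "T' k = {s \<in> T. e s v = k}" for k
  show ?case
  proof (rule insert.IH)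
    show "finite (T' (e t v))" "t \<in> T' (e t v)" using insert.prems by (auto simp: T'_def)
    show "s = s'" if "s \<in> T' (e t v)" "s' \<in> T' (e t v)" "\<forall>u\<in>V. e s u = e s' u" for s s'
      using that insert.prems(2)[of s s'] by (auto simp: T'_def)
    fix x :: "'v \<Rightarrow> complex" assume x: "\<forall>v. x v \<noteq> 0"
    define a where "a k = (\<Sum>s\<in>T' k. c s * (\<Prod>u\<in>V. x u ^ e s u))" for k
    define K where "K = (\<Sum>s\<in>T. e s v)"
    \<comment> \<open>\<open>p\<close> is the sum as a function of the coordinate at
      \<open>v\<close> alone, the others being fixed at \<open>x\<close>; \<open>K\<close> merely
      bounds its exponents.\<close>
    define p where "p = (\<Sum>k\<le>K. monom (a k) k)"
    have K: "e s v \<le> K" if "s \<in> T" for s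
      using that insert.prems(1) unfolding K_def by (intro member_le_sum) auto
    have "poly p z = 0" if z: "z \<noteq> 0" for z
    proof -
      have prod: "(\<Prod>u\<in>insert v V. (x(v := z)) u ^ e s u) = z ^ e s v * (\<Prod>u\<in>V. x u ^ e s u)" for s
      proof -
        have "(\<Prod>u\<in>V. (x(v := z)) u ^ e s u) = (\<Prod>u\<in>V. x u ^ e s u)"
          using insert.hyps by (intro prod.cong) auto
        then show ?thesis using insert.hyps by simp
      qed
      have "poly p z = (\<Sum>k\<le>K. \<Sum>s\<in>T' k. c s * (z ^ e s v * (\<Prod>u\<in>V. x u ^ e s u)))"
        by (auto simp: p_def poly_sum poly_monom a_def sum_distrib_right T'_def intro!: sum.cong)
      also have "\<dots> = (\<Sum>s\<in>T. c s * (z ^ e s v * (\<Prod>u\<in>V. x u ^ e s u)))"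
        unfolding T'_def using insert.prems(1) K by (intro sum.group) auto
      also have "\<dots> = 0" using insert.prems(3)[of "x(v := z)"] x z unfolding prod by simp
      finally show ?thesis .
    qed
    then have "UNIV - {0} \<subseteq> {z. poly p z = 0}" by auto
    then have "p = 0"
      using poly_roots_finite[of p] finite_subset infinite_UNIV_char_0[where 'a = complex]
      by (metis finite.emptyI finite_Diff2 finite.insertI)
    then have "coeff p (e t v) = 0" by simp
    moreover have "coeff p (e t v) = a (e t v)"
      using K[OF insert.prems(4)] by (simp add: p_def coeff_sum)
    ultimately show "(\<Sum>s\<in>T' (e t v). c s * (\<Prod>u\<in>V. x u ^ e s u)) = 0" by (simp add: a_def)
  qed
qed

text \<open>Points without zero coordinates are the ones that
  \<open>sub_grassmannian_free_coordinates\<close> can prescribe.\<close>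

lemma poly_eq_0_if_eval_eq_0:
  assumes "finite V" "f \<in> polys V" "\<And>x. \<forall>v. x v \<noteq> 0 \<Longrightarrow> poly_eval f x = 0"
  shows "f = 0"
proof -
  have "Poly_Mapping.lookup f t = 0" if t: "t \<in> Poly_Mapping.keys f" for t
  proof (rule monomials_independent[of V "Poly_Mapping.keys f" "Poly_Mapping.lookup" "Poly_Mapping.lookup f"])
    fix s t assume "s \<in> Poly_Mapping.keys f" "t \<in> Poly_Mapping.keys f"
      and "\<forall>v\<in>V. Poly_Mapping.lookup s v = Poly_Mapping.lookup t v"
    then show "s = t" using assms(2) unfolding polys_iff
      by (intro poly_mapping_eqI) (metis in_keys_iff subsetD)
  next
    fix x :: "'a \<Rightarrow> complex" assume x: "\<forall>v. x v \<noteq> 0"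
    have "(\<Prod>v\<in>V. x v ^ Poly_Mapping.lookup t v) = (\<Prod>v\<in>Poly_Mapping.keys t. x v ^ Poly_Mapping.lookup t v)"
      if "t \<in> Poly_Mapping.keys f" for t
      using that assms by (intro prod.mono_neutral_right) (auto simp: polys_iff in_keys_iff)
    then show "(\<Sum>t\<in>Poly_Mapping.keys f. Poly_Mapping.lookup f t * (\<Prod>v\<in>V. x v ^ Poly_Mapping.lookup t v)) = 0"
      using assms(3)[OF x] by (simp add: poly_subst_def)
  qed (use assms t in auto)
  then show ?thesis by (metis in_keys_iff keys_eq_empty equals0I)
qed


section \<open>Symmetric exchange\<close>

text \<open>For a monomial in Pluecker coordinates, given as a multiset of index sets, this is its
  weight under the torus.\<close>

definition ground :: "'a set multiset \<Rightarrow> 'a multiset" where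
  "ground U = \<Sum>\<^sub># (image_mset mset_set U)"

lemma ground_simps [simp]:
  "ground {#} = {#}" "ground (add_mset I U) = mset_set I + ground U"
  "ground (U + W) = ground U + ground W"
  by (auto simp: ground_def)

text \<open>Congruence of monomials modulo quadratic binomials of equal weight, in the chart of
  \<open>B\<close>: \<open>equiv_add\<close> is multiplication by a monomial, and
  \<open>equiv_cancel\<close> is division by the coordinate at \<open>B\<close>, a unit there.
  \<open>swap_equiv_localization\<close> makes this precise.\<close>

inductive swap_equiv :: "'a set set \<Rightarrow> 'a set \<Rightarrow> 'a set multiset \<Rightarrow> 'a set multiset \<Rightarrow> bool"
  for \<B> B where
  swap: "I \<in> \<B> \<Longrightarrow> J \<in> \<B> \<Longrightarrow> K \<in> \<B> \<Longrightarrow> L \<in> \<B> \<Longrightarrow> ground {#I, J#} = ground {#K, L#}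
    \<Longrightarrow> swap_equiv \<B> B {#I, J#} {#K, L#}"
| equiv_refl: "swap_equiv \<B> B U U"
| equiv_sym: "swap_equiv \<B> B U W \<Longrightarrow> swap_equiv \<B> B W U"
| equiv_trans [trans]: "swap_equiv \<B> B U W \<Longrightarrow> swap_equiv \<B> B W X \<Longrightarrow> swap_equiv \<B> B U X"
| equiv_add: "swap_equiv \<B> B U W \<Longrightarrow> swap_equiv \<B> B (U + X) (W + X)"
| equiv_cancel: "swap_equiv \<B> B (add_mset B U) (add_mset B W) \<Longrightarrow> swap_equiv \<B> B U W"

lemma swap_equiv_ground_eq:
  "swap_equiv \<B> B U W \<Longrightarrow> ground U = ground W \<and> size U = size W"
  by (induction rule: swap_equiv.induct) auto

lemma swap_equiv_add2:
  assumes "swap_equiv \<B> B U W" "swap_equiv \<B> B X Y"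
  shows "swap_equiv \<B> B (U + X) (W + Y)"
  using swap_equiv.equiv_add[OF assms(1), of X] swap_equiv.equiv_add[OF assms(2), of W]
  by (metis add.commute swap_equiv.equiv_trans)

lemma swap_equiv_cancel_replicate:
  "swap_equiv \<B> B (replicate_mset k B + U) (replicate_mset k B + W) \<Longrightarrow> swap_equiv \<B> B U W"
  by (induction k) (auto dest: swap_equiv.equiv_cancel)

text \<open>Like the weight identities below, this is stated additively to avoid truncated
  subtraction of multisets.\<close>

lemma mset_set_exchange:
  "finite I \<Longrightarrow> x \<in> I \<Longrightarrow> y \<notin> I \<Longrightarrow> add_mset x (mset_set (insert y (I - {x}))) = add_mset y (mset_set I)"
  using mset_set.remove[of I x] mset_set.insert[of "I - {x}" y] by simp

lemma replicate_mset_add: "replicate_mset (k + l) x = replicate_mset k x + replicate_mset l x"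
  by (induction k) auto

text \<open>The symmetric exchange property of matroid bases, with a reference basis
  \<open>B\<close>. Below, \<open>edge\<close> is the bipartite exchange graph of \<open>B\<close>,
  and \<open>nb\<close> sends an edge to the corresponding neighbour of \<open>B\<close>.\<close>

locale exchange_system =
  fixes \<B> :: "'a set set" and B :: "'a set"
  assumes finite_basis: "I \<in> \<B> \<Longrightarrow> finite I"
    and exchange: "I \<in> \<B> \<Longrightarrow> J \<in> \<B> \<Longrightarrow> x \<in> I - J \<Longrightarrow>
      \<exists>y\<in>J - I. insert y (I - {x}) \<in> \<B> \<and> insert x (J - {y}) \<in> \<B>"
    and B_basis: "B \<in> \<B>"
begin

definition nb :: "'a \<times> 'a \<Rightarrow> 'a set" where "nb p = insert (snd p) (B - {fst p})"

definition edge :: "'a \<Rightarrow> 'a \<Rightarrow> bool" where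
  "edge x y \<longleftrightarrow> x \<in> B \<and> y \<notin> B \<and> nb (x, y) \<in> \<B>"

abbreviation R (infix \<open>\<simeq>\<close> 50) where "U \<simeq> W \<equiv> swap_equiv \<B> B U W"

lemma finite_B [simp]: "finite B"
  using B_basis finite_basis by blast

lemma ground_nb: "edge x y \<Longrightarrow> add_mset x (mset_set (nb (x, y))) = add_mset y (mset_set B)"
  unfolding nb_def edge_def fst_conv snd_conv by (rule mset_set_exchange) auto

text \<open>When no left end of an earlier pair is joined to the right end of a later one, the pairs
  are the only perfect matching between their ends, and symmetric exchange is forced to follow them.
  In the chart of \<open>B\<close> the resulting basis is the product of the neighbours.\<close>

lemma triangular_exchange:
  assumes "\<forall>p\<in>set ps. edge (fst p) (snd p)"
    and "sorted_wrt (\<lambda>p p'. \<not> edge (fst p) (snd p')) ps"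
  defines "D \<equiv> (B - fst ` set ps) \<union> snd ` set ps"
  shows "D \<in> \<B>"
    and "add_mset D (replicate_mset (length ps) B) \<simeq> add_mset B (image_mset nb (mset ps))"
    and "mset_set D + image_mset fst (mset ps) = mset_set B + image_mset snd (mset ps)"
proof -
  define S where "S qs = (B - fst ` set qs) \<union> snd ` set qs" for qs :: "('a \<times> 'a) list"
  have "S ps \<in> \<B> \<and> add_mset (S ps) (replicate_mset (length ps) B) \<simeq> add_mset B (image_mset nb (mset ps))
    \<and> mset_set (S ps) + image_mset fst (mset ps) = mset_set B + image_mset snd (mset ps)"
    using assms(1,2)
  proof (induction ps rule: rev_induct)
    case Nil
    then show ?case by (auto simp: S_def B_basis swap_equiv.equiv_refl)
  next
    case (snoc p ps)
    obtain x y where p: "p = (x, y)" by fastforce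
    have e: "edge x y" and es: "\<And>q. q \<in> set ps \<Longrightarrow> edge (fst q) (snd q)"
      and ne: "\<And>q. q \<in> set ps \<Longrightarrow> \<not> edge (fst q) y"
      and sw: "sorted_wrt (\<lambda>p p'. \<not> edge (fst p) (snd p')) ps"
      using snoc.prems by (auto simp: p sorted_wrt_append)
    let ?D = "S ps" and ?E = "nb (x, y)"
    have IH: "?D \<in> \<B>" "add_mset ?D (replicate_mset (length ps) B) \<simeq> add_mset B (image_mset nb (mset ps))"
      "mset_set ?D + image_mset fst (mset ps) = mset_set B + image_mset snd (mset ps)"
      using snoc.IH es sw by auto
    have xB: "x \<in> B" and yB: "y \<notin> B" and E: "?E \<in> \<B>" using e by (auto simp: edge_def)
    \<comment> \<open>The order also excludes repeated ends: \<open>edge x y\<close> would join a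
      repeated left end \<open>x\<close> to the later \<open>y\<close>, and a repeated right end
      \<open>y\<close> is joined to an earlier left end.\<close>
    have xf: "x \<notin> fst ` set ps" using ne e by auto
    have yf: "y \<notin> snd ` set ps" using ne es by fastforce
    have sB: "snd ` set ps \<inter> B = {}" using es by (auto simp: edge_def)
    have xD: "x \<in> ?D - ?E" using xB xf yB by (auto simp: S_def nb_def)
    have yD: "y \<notin> ?D" using yB yf by (auto simp: S_def)
    \<comment> \<open>Taking \<open>x\<close> out of \<open>?D\<close> against \<open>?E\<close> can
      only bring in \<open>y\<close> or an element of \<open>B\<close> removed earlier; the latter
      would give an edge from an earlier left end to \<open>y\<close>.\<close>
    obtain z where z: "z \<in> ?E - ?D" "insert z (?D - {x}) \<in> \<B>" "insert x (?E - {z}) \<in> \<B>"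
      using exchange[OF IH(1) E xD] by blast
    have "z = y"
    proof (rule ccontr)
      assume "z \<noteq> y"
      with z(1) have "z \<in> B" "z \<noteq> x" "z \<in> fst ` set ps" by (auto simp: nb_def S_def)
      then obtain q where q: "q \<in> set ps" "z = fst q" by auto
      have "insert x (?E - {z}) = nb (z, y)"
        using \<open>z \<noteq> y\<close> \<open>z \<noteq> x\<close> xB by (auto simp: nb_def)
      with z(3) \<open>z \<in> B\<close> yB have "edge z y" by (auto simp: edge_def)
      with ne[OF q(1)] q(2) show False by simp
    qed
    have D': "S (ps @ [p]) = insert y (?D - {x})"
      using sB xB by (auto simp: S_def p)
    have D'B: "S (ps @ [p]) \<in> \<B>" using z(2) D' \<open>z = y\<close> by simp
    have fD: "finite ?D" using IH(1) finite_basis by blast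
    have c: "add_mset x (mset_set (S (ps @ [p]))) = add_mset y (mset_set ?D)"
      unfolding D' using fD xD yD by (intro mset_set_exchange) auto
    \<comment> \<open>The exchange is a swap of the pair \<open>?D\<close>, \<open>?E\<close>
      against the new basis and \<open>B\<close>; this accounts for one more factor
      \<open>B\<close>.\<close>
    have "add_mset x (mset_set (S (ps @ [p])) + mset_set B) = add_mset x (mset_set ?D + mset_set ?E)"
      using c ground_nb[OF e] by (metis union_mset_add_mset_left union_mset_add_mset_right)
    then have "{#S (ps @ [p]), B#} \<simeq> {#?D, ?E#}"
      by (intro swap_equiv.swap D'B B_basis IH(1) E) simp
    from swap_equiv.equiv_add[OF this, of "replicate_mset (length ps) B"]
    have "add_mset (S (ps @ [p])) (replicate_mset (length (ps @ [p])) B)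
        \<simeq> add_mset ?D (replicate_mset (length ps) B) + {#?E#}"
      by (simp add: add_mset_commute)
    also have "\<dots> \<simeq> add_mset B (image_mset nb (mset ps)) + {#?E#}"
      by (rule swap_equiv.equiv_add[OF IH(2)])
    finally have 2: "add_mset (S (ps @ [p])) (replicate_mset (length (ps @ [p])) B)
        \<simeq> add_mset B (image_mset nb (mset (ps @ [p])))" by (simp add: p add_mset_commute)
    have "mset_set (S (ps @ [p])) + image_mset fst (mset (ps @ [p]))
      = add_mset x (mset_set (S (ps @ [p]))) + image_mset fst (mset ps)" by (simp add: p)
    also have "\<dots> = mset_set B + image_mset snd (mset (ps @ [p]))"
      unfolding c using IH(3) by (simp add: p)
    finally show ?case using D'B 2 by simp
  qed
  then show "D \<in> \<B>"
    and "add_mset D (replicate_mset (length ps) B) \<simeq> add_mset B (image_mset nb (mset ps))"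
    and "mset_set D + image_mset fst (mset ps) = mset_set B + image_mset snd (mset ps)"
    by (auto simp: D_def S_def)
qed

text \<open>Two perfect matchings are connected through a third one sharing an edge with each of them,
  unless their union is a chordless cycle. In that case deleting one edge of each matching leaves
  triangular matchings, which assemble to two bases, so that a single swap suffices.\<close>

lemma matchings_swap_equiv:
  fixes f :: "'i \<Rightarrow> 'a" and e :: "'j \<Rightarrow> 'a"
  assumes "finite S" "bij_betw \<alpha> S T" "bij_betw \<beta> S T"
    and "\<forall>s\<in>S. edge (f s) (e (\<alpha> s))" "\<forall>s\<in>S. edge (f s) (e (\<beta> s))"
  shows "image_mset (\<lambda>s. nb (f s, e (\<alpha> s))) (mset_set S) \<simeq> image_mset (\<lambda>s. nb (f s, e (\<beta> s))) (mset_set S)"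
  using assms
proof (induction "card S" arbitrary: S T \<alpha> \<beta> rule: less_induct)
  case less
  note fin = less.prems(1) and b\<alpha> = less.prems(2) and b\<beta> = less.prems(3)
    and e\<alpha> = less.prems(4) and e\<beta> = less.prems(5)
  let ?M = "\<lambda>\<gamma> S. image_mset (\<lambda>s. nb (f s, e (\<gamma> s))) (mset_set S)"
  \<comment> \<open>Two matchings with a common edge: remove it and apply the induction hypothesis
    to the rest.\<close>
  have share: "?M \<gamma> S \<simeq> ?M \<delta> S"
    if "bij_betw \<gamma> S T" "bij_betw \<delta> S T" "\<forall>s\<in>S. edge (f s) (e (\<gamma> s))"
      "\<forall>s\<in>S. edge (f s) (e (\<delta> s))" and s: "s \<in> S" "\<gamma> s = \<delta> s" for \<gamma> \<delta> s
  proof -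
    have rem: "bij_betw \<eta> (S - {s}) (T - {\<eta> s})" if "bij_betw \<eta> S T" for \<eta>
      using that s(1) by (auto simp: bij_betw_def inj_on_diff inj_on_image_set_diff[of \<eta> S])
    have "card (S - {s}) < card S" using s(1) fin by (rule card_Diff1_less[rotated])
    then have "?M \<gamma> (S - {s}) \<simeq> ?M \<delta> (S - {s})"
      using rem[OF that(1)] rem[OF that(2)] that fin by (intro less.hyps) auto
    from swap_equiv.equiv_add[OF this, of "{#nb (f s, e (\<gamma> s))#}"] show ?thesis
      unfolding mset_set.remove[OF fin s(1)] using s(2) by (simp del: mset_set_Diff)
  qed
  show ?case
  \<comment> \<open>With \<open>\<gamma> = \<alpha>\<close> this case includes a common edge of
    \<open>\<alpha>\<close> and \<open>\<beta>\<close>, so \<open>no_mid\<close> also makes the two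
    matchings disjoint.\<close>
  proof (cases "\<exists>\<gamma> s s'. bij_betw \<gamma> S T \<and> (\<forall>s\<in>S. edge (f s) (e (\<gamma> s))) \<and> s \<in> S \<and> s' \<in> S
      \<and> \<alpha> s = \<gamma> s \<and> \<gamma> s' = \<beta> s'")
    case True
    then obtain \<gamma> s s' where \<gamma>: "bij_betw \<gamma> S T" "\<forall>s\<in>S. edge (f s) (e (\<gamma> s))"
      and s: "s \<in> S" "\<alpha> s = \<gamma> s" "s' \<in> S" "\<gamma> s' = \<beta> s'" by blast
    show ?thesis
      by (rule swap_equiv.equiv_trans[OF share[OF b\<alpha> \<gamma>(1) e\<alpha> \<gamma>(2) s(1,2)] share[OF \<gamma>(1) b\<beta> \<gamma>(2) e\<beta> s(3,4)]])
  next
    case no_mid: False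
    show ?thesis
    proof (cases "S = {}")
      case True
      then show ?thesis by (simp add: swap_equiv.equiv_refl)
    next
      case False
      then obtain s0 where s0: "s0 \<in> S" by blast
      \<comment> \<open>The union of the matchings decomposes into alternating cycles: from
        \<open>s\<close> along \<open>\<alpha>\<close> and back along \<open>\<beta>\<close> leads
        to \<open>\<pi> s\<close>. The orbit \<open>q\<close> of \<open>s0\<close> is one such
        cycle, of length \<open>N\<close>.\<close>
      define \<pi> where "\<pi> s = inv_into S \<beta> (\<alpha> s)" for s
      have \<pi>S: "\<pi> s \<in> S" and \<beta>\<pi>: "\<beta> (\<pi> s) = \<alpha> s" if "s \<in> S" for s
        using that b\<alpha> b\<beta> unfolding \<pi>_def bij_betw_def
        by (metis imageI inv_into_into, metis f_inv_into_f imageI)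
      have inj\<pi>: "s = s'" if "\<pi> s = \<pi> s'" "s \<in> S" "s' \<in> S" for s s'
        using that \<beta>\<pi> b\<alpha> by (metis bij_betw_def inj_onD)
      define q where "q k = (\<pi> ^^ k) s0" for k
      have qS: "q k \<in> S" for k by (induction k) (auto simp: q_def s0 \<pi>S)
      have \<alpha>q: "\<alpha> (q k) = \<beta> (q (Suc k))" for k using \<beta>\<pi>[OF qS] by (simp add: q_def)
      have q0: "q 0 = s0" by (simp add: q_def)
      \<comment> \<open>Injectivity of \<open>\<pi>\<close> makes the orbit periodic from its start,
        so that the first repetition is a return to \<open>s0\<close>.\<close>
      have shift: "q d = s0" if "q (i + d) = q i" for i d
        using that
      proof (induction i)
        case (Suc i)
        then have "\<pi> (q (i + d)) = \<pi> (q i)" by (simp add: q_def)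
        then show ?case using Suc.IH inj\<pi> qS by blast
      qed (simp add: q0)
      have "\<not> inj q" using fin qS by (meson finite_imageD finite_subset image_subset_iff infinite_UNIV_nat)
      then obtain i d where "d > 0" "q (i + d) = q i"
        by (metis (mono_tags, lifting) injI less_imp_add_positive linorder_neqE_nat)
      then have ex: "\<exists>d>0. q d = s0" using shift by blast
      define N where "N = (LEAST d. d > 0 \<and> q d = s0)"
      have N: "N > 0" "q N = s0" using LeastI_ex[OF ex] by (auto simp: N_def)
      have Nmin: "q d \<noteq> s0" if "0 < d" "d < N" for d
        using not_less_Least[of d "\<lambda>d. d > 0 \<and> q d = s0"] that by (auto simp: N_def)
      have injq: "i = j" if "q i = q j" "i < N" "j < N" for i j
      proof (rule ccontr)
        assume "i \<noteq> j"
        then show False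
          using that shift[of i "j - i"] shift[of j "i - j"] Nmin[of "j - i"] Nmin[of "i - j"]
          by (cases "i < j") auto
      qed
      define C where "C = q ` {..<N}"
      have CS: "C \<subseteq> S" using qS by (auto simp: C_def)
      have im: "\<alpha> ` C = \<beta> ` C"
      proof -
        have "\<alpha> ` C = \<beta> ` q ` (Suc ` {..<N})" by (auto simp: C_def \<alpha>q image_image)
        also have "q ` (Suc ` {..<N}) = C"
        proof
          show "q ` (Suc ` {..<N}) \<subseteq> C"
          proof
            fix s assume "s \<in> q ` (Suc ` {..<N})"
            then obtain k where k: "k < N" "s = q (Suc k)" by auto
            show "s \<in> C"
            proof (cases "Suc k = N")
              case True
              then show ?thesis using k N q0 by (auto simp: C_def intro!: image_eqI[of _ _ 0])
            qed (use k in \<open>auto simp: C_def intro!: image_eqI[of _ _ "Suc k"]\<close>)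
          qed
          show "C \<subseteq> q ` (Suc ` {..<N})"
          proof
            fix s assume "s \<in> C"
            then obtain k where k: "k < N" "s = q k" by (auto simp: C_def)
            show "s \<in> q ` (Suc ` {..<N})"
            proof (cases k)
              case 0
              then have "s = q (Suc (N - 1))" using k N q0 by simp
              moreover have "Suc (N - 1) \<in> Suc ` {..<N}" using N(1) by (intro imageI) auto
              ultimately show ?thesis by blast
            qed (use k in auto)
          qed
        qed
        finally show ?thesis .
      qed
      have surj_bij: "bij_betw \<gamma> S T" if "\<gamma> ` S = T" for \<gamma>
        using that eq_card_imp_inj_on[of S \<gamma>] fin bij_betw_same_card[OF b\<alpha>] by (auto simp: bij_betw_def)
      have \<alpha>T: "\<alpha> ` S = T" and \<beta>T: "\<beta> ` S = T" using b\<alpha> b\<beta> by (auto simp: bij_betw_def)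
      \<comment> \<open>A second cycle would allow \<open>\<beta>\<close> on \<open>C\<close> and
        \<open>\<alpha>\<close> elsewhere, a matching that meets both.\<close>
      have "C = S"
      proof (rule ccontr)
        assume "C \<noteq> S"
        then obtain s1 where s1: "s1 \<in> S" "s1 \<notin> C" using CS by blast
        define \<gamma> where "\<gamma> s = (if s \<in> C then \<beta> s else \<alpha> s)" for s
        have "\<gamma> ` S = \<gamma> ` C \<union> \<gamma> ` (S - C)" using CS by blast
        also have "\<gamma> ` C = \<alpha> ` C" using im by (auto simp: \<gamma>_def)
        also have "\<gamma> ` (S - C) = \<alpha> ` (S - C)" by (auto simp: \<gamma>_def)
        also have "\<alpha> ` C \<union> \<alpha> ` (S - C) = T" using \<alpha>T CS by blast
        finally have "bij_betw \<gamma> S T" by (rule surj_bij)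
        moreover have "\<forall>s\<in>S. edge (f s) (e (\<gamma> s))" using e\<alpha> e\<beta> by (auto simp: \<gamma>_def)
        moreover have "s0 \<in> C" using N q0 by (auto simp: C_def intro!: image_eqI[of _ _ 0])
        ultimately show False using no_mid s1 s0 by (metis \<gamma>_def)
      qed
      \<comment> \<open>A chord gives a middle matching: \<open>q j\<close> uses it, the positions
        after \<open>j\<close> up to \<open>k\<close> change to \<open>\<beta>\<close>, all others
        keep \<open>\<alpha>\<close>. It agrees with \<open>\<alpha>\<close> at \<open>q 0\<close>,
        which needs \<open>0 < j\<close>, and with \<open>\<beta>\<close> at
        \<open>q k\<close>.\<close>
      have chord1: "\<not> edge (f (q j)) (e (\<alpha> (q k)))" if jk: "0 < j" "j < k" "k < N" for j k
      proof
        assume ed: "edge (f (q j)) (e (\<alpha> (q k)))"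
        define \<gamma> where "\<gamma> s = (if s = q j then \<alpha> (q k) else if s \<in> q ` {j<..k} then \<beta> s else \<alpha> s)" for s
        have "T \<subseteq> \<gamma> ` S"
        proof
          fix t assume "t \<in> T"
          then obtain s where s: "s \<in> S" "t = \<alpha> s" using \<alpha>T by blast
          then obtain r where r: "r < N" "s = q r" using \<open>C = S\<close> by (auto simp: C_def)
          consider "r < j \<or> k < r" | "r = k" | "j \<le> r" "r < k" by linarith
          then show "t \<in> \<gamma> ` S"
          proof cases
            case 1
            then have "\<gamma> s = t" using s r jk injq by (force simp: \<gamma>_def)
            then show ?thesis using s by blast
          next
            case 2
            then have "t = \<gamma> (q j)" using s r by (simp add: \<gamma>_def)
            then show ?thesis using qS by blast
          next
            case 3
            then have "q (Suc r) \<noteq> q j" using injq[of "Suc r" j] jk by auto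
            then have "\<gamma> (q (Suc r)) = t" using 3 s r \<alpha>q by (auto simp: \<gamma>_def)
            then show ?thesis using qS by blast
          qed
        qed
        moreover have "\<gamma> ` S \<subseteq> T" using \<alpha>T \<beta>T qS by (auto simp: \<gamma>_def)
        ultimately have "bij_betw \<gamma> S T" by (intro surj_bij) auto
        moreover have "\<forall>s\<in>S. edge (f s) (e (\<gamma> s))" using e\<alpha> e\<beta> ed by (auto simp: \<gamma>_def)
        moreover have "\<alpha> (q 0) = \<gamma> (q 0)"
          using jk injq[of 0] by (force simp: \<gamma>_def)
        moreover have "\<gamma> (q k) = \<beta> (q k)"
          using jk injq[of k j] by (auto simp: \<gamma>_def)
        ultimately show False using no_mid qS by blast
      qed
      \<comment> \<open>The mirror image: the two matchings are interchanged and the cycle is run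
        backwards.\<close>
      have chord2: "\<not> edge (f (q j)) (e (\<beta> (q k)))" if jk: "0 < k" "k < j" "j < N" for j k
      proof
        assume ed: "edge (f (q j)) (e (\<beta> (q k)))"
        define \<gamma> where "\<gamma> s = (if s = q j then \<beta> (q k) else if s \<in> q ` {k..<j} then \<alpha> s else \<beta> s)" for s
        have "T \<subseteq> \<gamma> ` S"
        proof
          fix t assume "t \<in> T"
          then obtain s where s: "s \<in> S" "t = \<beta> s" using \<beta>T by blast
          then obtain r where r: "r < N" "s = q r" using \<open>C = S\<close> by (auto simp: C_def)
          consider "r < k \<or> j < r" | "r = k" | "k < r" "r \<le> j" by linarith
          then show "t \<in> \<gamma> ` S"
          proof cases
            case 1
            then have "\<gamma> s = t" using s r jk injq by (force simp: \<gamma>_def)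
            then show ?thesis using s by blast
          next
            case 2
            then have "t = \<gamma> (q j)" using s r by (simp add: \<gamma>_def)
            then show ?thesis using qS by blast
          next
            case 3
            then have "r - 1 < N" "r - 1 \<noteq> j" using jk by linarith+
            then have "q (r - 1) \<noteq> q j" using injq jk by blast
            moreover have "r - 1 \<in> {k..<j}" "Suc (r - 1) = r" using 3 by auto
            ultimately have "\<gamma> (q (r - 1)) = t" using s r \<alpha>q[of "r - 1"] by (auto simp: \<gamma>_def)
            then show ?thesis using qS by blast
          qed
        qed
        moreover have "\<gamma> ` S \<subseteq> T" using \<alpha>T \<beta>T qS by (auto simp: \<gamma>_def)
        ultimately have "bij_betw \<gamma> S T" by (intro surj_bij) auto
        moreover have "\<forall>s\<in>S. edge (f s) (e (\<gamma> s))" using e\<alpha> e\<beta> ed by (auto simp: \<gamma>_def)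
        moreover have "\<gamma> (q 0) = \<beta> (q 0)"
          using jk injq[of 0] by (force simp: \<gamma>_def)
        moreover have "\<alpha> (q k) = \<gamma> (q k)"
          using jk injq[of k j] by (auto simp: \<gamma>_def)
        ultimately show False using no_mid qS by blast
      qed
      have mS: "mset_set S = add_mset s0 (image_mset q (mset [1..<N]))"
      proof -
        have "mset_set S = image_mset q (mset_set {..<N})"
          using \<open>C = S\<close> injq by (subst image_mset_mset_set) (auto simp: C_def inj_on_def)
        also have "mset_set {..<N} = mset [0..<N]" by (simp add: atLeast0LessThan)
        also have "[0..<N] = 0 # [1..<N]" using N by (simp add: upt_conv_Cons)
        finally show ?thesis by (simp add: q0)
      qed
      \<comment> \<open>Deleting the edge at \<open>s0\<close> leaves pairs that are triangular in
        the order \<open>ks\<close>, hence a basis \<open>D\<close>. The identity determines the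
        union of \<open>D\<close> and the deleted neighbour without reference to
        \<open>\<gamma>\<close>, which makes the final swap possible.\<close>
      have main: "\<exists>D\<in>\<B>. add_mset B (?M \<gamma> S) \<simeq> add_mset D (replicate_mset (N - 1) B) + {#nb (f s0, e (\<gamma> s0))#}
          \<and> ground {#nb (f s0, e (\<gamma> s0)), D#} + image_mset f (mset_set S)
            = mset_set B + mset_set B + image_mset e (mset_set T)"
        if b: "bij_betw \<gamma> S T" and ed: "\<forall>s\<in>S. edge (f s) (e (\<gamma> s))"
          and so: "sorted_wrt (\<lambda>j k. \<not> edge (f (q j)) (e (\<gamma> (q k)))) ks"
          and ks: "mset ks = mset [1..<N]" for \<gamma> ks
      proof -
        define ps where "ps = map (\<lambda>k. (f (q k), e (\<gamma> (q k)))) ks"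
        define D where "D = (B - fst ` set ps) \<union> snd ` set ps"
        have 1: "\<forall>p\<in>set ps. edge (fst p) (snd p)" using ed qS by (auto simp: ps_def)
        have 2: "sorted_wrt (\<lambda>p p'. \<not> edge (fst p) (snd p')) ps"
          using so by (simp add: ps_def sorted_wrt_map)
        note tri = triangular_exchange[OF 1 2, folded D_def]
        have len: "length ps = N - 1" using arg_cong[OF ks, of size] by (simp add: ps_def)
        have "?M \<gamma> S = add_mset (nb (f s0, e (\<gamma> s0))) (image_mset nb (mset ps))"
          by (simp add: mS ps_def ks image_mset.compositionality comp_def del: mset_upt)
        then have R: "add_mset B (?M \<gamma> S) \<simeq> add_mset D (replicate_mset (N - 1) B) + {#nb (f s0, e (\<gamma> s0))#}"
          using swap_equiv.equiv_add[OF swap_equiv.equiv_sym[OF tri(2)], of "{#nb (f s0, e (\<gamma> s0))#}"]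
          by (simp add: len add_mset_commute)
        have fp: "image_mset fst (mset ps) = image_mset f (image_mset q (mset [1..<N]))"
          and sp: "image_mset snd (mset ps) = image_mset e (image_mset \<gamma> (image_mset q (mset [1..<N])))"
          by (simp_all add: ps_def ks image_mset.compositionality comp_def del: mset_upt)
        have "ground {#nb (f s0, e (\<gamma> s0)), D#} + image_mset f (mset_set S)
          = add_mset (f s0) (mset_set (nb (f s0, e (\<gamma> s0)))) + (mset_set D + image_mset fst (mset ps))"
          unfolding mS fp by simp
        also have "\<dots> = add_mset (e (\<gamma> s0)) (mset_set B) + (mset_set B + image_mset snd (mset ps))"
          using ground_nb ed s0 tri(3) by simp
        also have "\<dots> = mset_set B + mset_set B + image_mset e (image_mset \<gamma> (mset_set S))"
          unfolding mS sp by simp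
        also have "image_mset \<gamma> (mset_set S) = mset_set T"
          using b by (auto simp: bij_betw_def image_mset_mset_set)
        finally show ?thesis using R tri(1) by blast
      qed
      \<comment> \<open>Without chords, the order along the cycle is triangular for
        \<open>\<alpha>\<close> and its reverse is triangular for \<open>\<beta>\<close>.\<close>
      have so1: "sorted_wrt (\<lambda>j k. \<not> edge (f (q j)) (e (\<alpha> (q k)))) [1..<N]"
        by (simp add: sorted_wrt_iff_nth_less chord1)
      have so2: "sorted_wrt (\<lambda>j k. \<not> edge (f (q j)) (e (\<beta> (q k)))) (rev [1..<N])"
        unfolding sorted_wrt_rev by (simp add: sorted_wrt_iff_nth_less chord2)
      obtain D1 where D1: "D1 \<in> \<B>"
        "add_mset B (?M \<alpha> S) \<simeq> add_mset D1 (replicate_mset (N - 1) B) + {#nb (f s0, e (\<alpha> s0))#}"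
        "ground {#nb (f s0, e (\<alpha> s0)), D1#} + image_mset f (mset_set S)
            = mset_set B + mset_set B + image_mset e (mset_set T)"
        using main[OF b\<alpha> e\<alpha> so1] by blast
      obtain D2 where D2: "D2 \<in> \<B>"
        "add_mset B (?M \<beta> S) \<simeq> add_mset D2 (replicate_mset (N - 1) B) + {#nb (f s0, e (\<beta> s0))#}"
        "ground {#nb (f s0, e (\<beta> s0)), D2#} + image_mset f (mset_set S)
            = mset_set B + mset_set B + image_mset e (mset_set T)"
        using main[OF b\<beta> e\<beta> so2] by auto
      have "{#nb (f s0, e (\<alpha> s0)), D1#} \<simeq> {#nb (f s0, e (\<beta> s0)), D2#}"
        using e\<alpha> e\<beta> s0 D1(1,3) D2(1,3)
        by (intro swap_equiv.swap) (auto simp: edge_def, metis add_right_imp_eq)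
      from swap_equiv.equiv_add[OF this, of "replicate_mset (N - 1) B"]
      have "add_mset D1 (replicate_mset (N - 1) B) + {#nb (f s0, e (\<alpha> s0))#}
          \<simeq> add_mset D2 (replicate_mset (N - 1) B) + {#nb (f s0, e (\<beta> s0))#}"
        by (simp add: add_mset_commute)
      then have "add_mset B (?M \<alpha> S) \<simeq> add_mset B (?M \<beta> S)"
        using D1(2) D2(2) by (meson swap_equiv.equiv_sym swap_equiv.equiv_trans)
      then show ?thesis by (rule swap_equiv.equiv_cancel)
    qed
  qed
qed

text \<open>Two multigraphs with equal degrees become two perfect matchings on half-edges: the
  positions in a list of the edges of \<open>X\<close> label both sides, \<open>X\<close> is the
  identity and \<open>Y\<close> a permutation \<open>\<sigma>\<close>. For this reason
  \<open>matchings_swap_equiv\<close> lets the labels \<open>f\<close> and \<open>e\<close>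
  repeat.\<close>

lemma neighbours_swap_equiv:
  assumes "\<forall>p\<in>#X. edge (fst p) (snd p)" "\<forall>p\<in>#Y. edge (fst p) (snd p)"
    and "image_mset fst X = image_mset fst Y" "image_mset snd X = image_mset snd Y"
  shows "image_mset nb X \<simeq> image_mset nb Y"
proof -
  obtain xs ys0 where xs: "mset xs = X" and ys0: "mset ys0 = Y" by (metis ex_mset)
  have "mset (map fst xs) = mset (map fst ys0)" using assms(3) xs ys0 by simp
  \<comment> \<open>Reordering \<open>Y\<close> aligns its left ends with those of \<open>X\<close>;
    the right ends then differ by \<open>\<sigma>\<close>.\<close>
  then obtain p where p: "p permutes {..<length ys0}" "permute_list p (map fst ys0) = map fst xs"
    using mset_eq_permutation by (metis length_map)
  define ys where "ys = permute_list p ys0"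
  have ys: "mset ys = Y" "map fst ys = map fst xs"
    using p ys0 by (auto simp: ys_def permute_list_map)
  have len: "length ys = length xs" using ys(2) map_eq_imp_length_eq by blast
  have "mset (map snd ys) = mset (map snd xs)" using assms(4) xs ys by simp
  then obtain \<sigma> where \<sigma>: "\<sigma> permutes {..<length xs}" "permute_list \<sigma> (map snd xs) = map snd ys"
    using mset_eq_permutation by (metis length_map)
  let ?S = "{..<length xs}" and ?f = "\<lambda>i. fst (xs ! i)" and ?e = "\<lambda>i. snd (xs ! i)"
  have snd_ys: "snd (ys ! i) = ?e (\<sigma> i)" if "i \<in> ?S" for i
    using that \<sigma> len permute_list_nth[of \<sigma> "map snd xs" i] permutes_in_image[OF \<sigma>(1), of i] by auto
  have fst_ys: "fst (ys ! i) = ?f i" if "i \<in> ?S" for i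
    using that ys(2) len by (metis lessThan_iff nth_map)
  have M: "image_mset g (mset zs) = image_mset (\<lambda>i. g (zs ! i)) (mset_set {..<length zs})"
    for g :: "'a \<times> 'a \<Rightarrow> 'a set" and zs
  proof -
    have "mset zs = image_mset (\<lambda>i. zs ! i) (mset [0..<length zs])"
      by (metis map_nth mset_map)
    then show ?thesis by (simp add: image_mset.compositionality comp_def atLeast0LessThan)
  qed
  have "image_mset (\<lambda>i. nb (?f i, ?e (id i))) (mset_set ?S)
      \<simeq> image_mset (\<lambda>i. nb (?f i, ?e (\<sigma> i))) (mset_set ?S)"
  proof (rule matchings_swap_equiv[where f = ?f and e = ?e and T = ?S])
    show "bij_betw \<sigma> ?S ?S" using \<sigma>(1) by (rule permutes_imp_bij)
    show "\<forall>i\<in>?S. edge (?f i) (?e (id i))" using assms(1) xs by auto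
    show "\<forall>i\<in>?S. edge (?f i) (?e (\<sigma> i))"
    proof
      fix i assume i: "i \<in> ?S"
      then have "ys ! i \<in># Y" using ys(1) len by auto
      then show "edge (?f i) (?e (\<sigma> i))" using assms(2) fst_ys[OF i] snd_ys[OF i] by metis
    qed
  qed (auto simp: bij_betw_def)
  moreover have "image_mset (\<lambda>i. nb (?f i, ?e (\<sigma> i))) (mset_set ?S) = image_mset nb Y"
    unfolding ys(1)[symmetric] M len
    by (intro image_mset_cong) (auto simp: snd_ys[symmetric] fst_ys[symmetric])
  ultimately show ?thesis unfolding xs[symmetric] M by simp
qed

text \<open>At the cost of one factor \<open>B\<close>, a symmetric exchange of \<open>D\<close>
  with \<open>B\<close> replaces \<open>D\<close> by a neighbour of \<open>B\<close> and a basis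
  closer to \<open>B\<close>.\<close>

lemma basis_swap_equiv_neighbours:
  assumes "D \<in> \<B>"
  shows "\<exists>k l X. (\<forall>p\<in>#X. edge (fst p) (snd p)) \<and>
    replicate_mset k B + {#D#} \<simeq> replicate_mset l B + image_mset nb X"
  using assms
proof (induction "card (D - B)" arbitrary: D rule: less_induct)
  case less
  have finD: "finite D" using less.prems finite_basis by blast
  show ?case
  proof (cases "D - B = {}")
    case True
    \<comment> \<open>An element of \<open>B - D\<close> would have an exchange partner in the empty
      set \<open>D - B\<close>.\<close>
    then have "D = B" using exchange[OF B_basis less.prems] by blast
    then have "replicate_mset 0 B + {#D#} \<simeq> replicate_mset 1 B + image_mset nb {#}"
      by (simp add: swap_equiv.equiv_refl)
    then show ?thesis by (metis empty_iff set_mset_empty)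
  next
    case False
    then obtain x where x: "x \<in> D - B" by blast
    obtain y where y: "y \<in> B - D" "insert y (D - {x}) \<in> \<B>" "insert x (B - {y}) \<in> \<B>"
      using exchange[OF less.prems B_basis x] by blast
    let ?D = "insert y (D - {x})"
    have "?D - B = (D - B) - {x}" using y x by auto
    then have "card (?D - B) < card (D - B)" using x finD
      by (metis card_Diff1_less finite_Diff)
    from less.hyps[OF this y(2)] obtain k l X where X: "\<forall>p\<in>#X. edge (fst p) (snd p)"
      "replicate_mset k B + {#?D#} \<simeq> replicate_mset l B + image_mset nb X" by blast
    have ed: "edge y x" using x y by (auto simp: edge_def nb_def)
    have "add_mset x (add_mset y (mset_set ?D + mset_set (nb (y, x))))
        = add_mset x (mset_set ?D) + add_mset y (mset_set (nb (y, x)))" by simp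
    also have "\<dots> = add_mset y (mset_set D) + add_mset x (mset_set B)"
      using mset_set_exchange[of D x y] ground_nb[OF ed] finD x y by auto
    finally have "{#D, B#} \<simeq> {#?D, nb (y, x)#}"
      using y ed less.prems B_basis by (intro swap_equiv.swap) (auto simp: edge_def ac_simps)
    from swap_equiv.equiv_add[OF this, of "replicate_mset k B"]
    have "replicate_mset (Suc k) B + {#D#} \<simeq> (replicate_mset k B + {#?D#}) + {#nb (y, x)#}"
      by (simp add: add_mset_commute)
    also have "\<dots> \<simeq> (replicate_mset l B + image_mset nb X) + {#nb (y, x)#}"
      by (rule swap_equiv.equiv_add[OF X(2)])
    also have "\<dots> = replicate_mset l B + image_mset nb (add_mset (y, x) X)" by simp
    finally show ?thesis using X(1) ed
      by (intro exI[of _ "Suc k"] exI[of _ l] exI[of _ "add_mset (y, x) X"]) auto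
  qed
qed

lemma swap_equiv_neighbours:
  assumes "set_mset U \<subseteq> \<B>"
  shows "\<exists>k l X. (\<forall>p\<in>#X. edge (fst p) (snd p)) \<and>
    replicate_mset k B + U \<simeq> replicate_mset l B + image_mset nb X"
  using assms
proof (induction U)
  case empty
  show ?case by (metis empty_iff set_mset_empty image_mset_empty swap_equiv.equiv_refl)
next
  case (add D U)
  obtain k l X where X: "\<forall>p\<in>#X. edge (fst p) (snd p)"
    "replicate_mset k B + U \<simeq> replicate_mset l B + image_mset nb X" using add by auto
  obtain k' l' X' where X': "\<forall>p\<in>#X'. edge (fst p) (snd p)"
    "replicate_mset k' B + {#D#} \<simeq> replicate_mset l' B + image_mset nb X'"
    using basis_swap_equiv_neighbours add.prems by force
  from swap_equiv_add2[OF X(2) X'(2)]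
  have "replicate_mset (k + k') B + add_mset D U \<simeq> replicate_mset (l + l') B + image_mset nb (X + X')"
    by (simp add: replicate_mset_add ac_simps)
  then show ?case using X(1) X'(1) by (metis union_iff)
qed

text \<open>Each edge removes its left end from a copy of \<open>B\<close> and adds its right end,
  so the union and the number of factors determine the degrees of the multigraph.\<close>

lemma ground_neighbours:
  "\<forall>p\<in>#X. edge (fst p) (snd p) \<Longrightarrow>
    ground (replicate_mset l B + image_mset nb X) + image_mset fst X
      = repeat_mset (l + size X) (mset_set B) + image_mset snd X"
proof (induction X)
  case empty
  show ?case by (induction l) auto
next
  case (add p X)
  have "ground (replicate_mset l B + image_mset nb (add_mset p X)) + image_mset fst (add_mset p X)
    = (ground (replicate_mset l B + image_mset nb X) + image_mset fst X)
      + add_mset (fst p) (mset_set (nb (fst p, snd p)))" by simp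
  also have "\<dots> = repeat_mset (l + size (add_mset p X)) (mset_set B) + image_mset snd (add_mset p X)"
    using add ground_nb[of "fst p" "snd p"] by simp
  finally show ?case .
qed

theorem swap_equiv_if_ground_eq:
  assumes "set_mset U \<subseteq> \<B>" "set_mset W \<subseteq> \<B>" "ground U = ground W" "size U = size W"
  shows "U \<simeq> W"
proof -
  obtain k l X where X: "\<forall>p\<in>#X. edge (fst p) (snd p)"
    "replicate_mset k B + U \<simeq> replicate_mset l B + image_mset nb X"
    using swap_equiv_neighbours[OF assms(1)] by blast
  obtain k' l' Y where Y: "\<forall>p\<in>#Y. edge (fst p) (snd p)"
    "replicate_mset k' B + W \<simeq> replicate_mset l' B + image_mset nb Y"
    using swap_equiv_neighbours[OF assms(2)] by blast
  \<comment> \<open>Each side is multiplied by the power of \<open>B\<close> that the other one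
    needs, so that both use \<open>k + k'\<close> copies.\<close>
  let ?U = "replicate_mset (k' + l) B + image_mset nb X" and ?W = "replicate_mset (k + l') B + image_mset nb Y"
  have U: "replicate_mset (k + k') B + U \<simeq> ?U"
    using swap_equiv.equiv_add[OF X(2), of "replicate_mset k' B"] by (simp add: replicate_mset_add ac_simps)
  have W: "replicate_mset (k + k') B + W \<simeq> ?W"
    using swap_equiv.equiv_add[OF Y(2), of "replicate_mset k B"] by (simp add: replicate_mset_add ac_simps)
  have c: "ground ?U = ground ?W" "size ?U = size ?W"
    using swap_equiv_ground_eq[OF U] swap_equiv_ground_eq[OF W] assms(3,4) by auto
  have eq: "image_mset fst X + image_mset snd Y = image_mset fst Y + image_mset snd X"
    using ground_neighbours[OF X(1), of "k' + l"] ground_neighbours[OF Y(1), of "k + l'"] c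
    by (smt (verit) add.assoc add.commute add_left_imp_eq size_image_mset size_replicate_mset size_union)
  \<comment> \<open>Left ends lie in \<open>B\<close> and right ends outside, so filtering splits
    \<open>eq\<close> into the degree conditions of the two sides of the graph.\<close>
  have f: "filter_mset (\<lambda>x. x \<in> B) (image_mset fst Z) = image_mset fst Z"
    "filter_mset (\<lambda>x. x \<in> B) (image_mset snd Z) = {#}"
    "filter_mset (\<lambda>x. x \<notin> B) (image_mset snd Z) = image_mset snd Z"
    "filter_mset (\<lambda>x. x \<notin> B) (image_mset fst Z) = {#}"
    if "\<forall>p\<in>#Z. edge (fst p) (snd p)" for Z
    using that by (auto simp: edge_def filter_mset_eq_conv)
  have "image_mset fst X = image_mset fst Y" "image_mset snd X = image_mset snd Y"
    using arg_cong[OF eq, of "filter_mset (\<lambda>x. x \<in> B)"] arg_cong[OF eq, of "filter_mset (\<lambda>x. x \<notin> B)"]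
    by (simp_all add: f X(1) Y(1))
  from neighbours_swap_equiv[OF X(1) Y(1) this] have nbs: "image_mset nb X \<simeq> image_mset nb Y" .
  \<comment> \<open>The total sizes agree, so equal numbers of edges leave equal powers of
    \<open>B\<close>.\<close>
  then have "size X = size Y" using swap_equiv_ground_eq[OF nbs] by simp
  then have "k' + l = k + l'" using c(2) by simp
  then have "?U \<simeq> ?W" using swap_equiv_add2[OF swap_equiv.equiv_refl nbs] by simp
  then have "replicate_mset (k + k') B + U \<simeq> replicate_mset (k + k') B + W"
    using U W by (meson swap_equiv.equiv_sym swap_equiv.equiv_trans)
  then show ?thesis by (rule swap_equiv_cancel_replicate)
qed

end


section \<open>Pluecker coordinates\<close>

lemma card_less_nth_sorted_list:
  fixes I :: "nat set"
  assumes "finite I" "i < card I"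
  shows "card {a \<in> I. a < sorted_list_of_set I ! i} = i"
proof -
  let ?xs = "sorted_list_of_set I"
  have sw: "sorted_wrt (<) ?xs" and len: "length ?xs = card I" and set: "set ?xs = I"
    using assms(1) by (auto simp: strict_sorted_list_of_set)
  have "{a \<in> I. a < ?xs ! i} = (\<lambda>k. ?xs ! k) ` {..<i}"
  proof (intro equalityI subsetI)
    fix a assume "a \<in> {a \<in> I. a < ?xs ! i}"
    then obtain k where k: "k < length ?xs" "a = ?xs ! k" "?xs ! k < ?xs ! i"
      using set by (metis (mono_tags, lifting) in_set_conv_nth mem_Collect_eq)
    then have "\<not> i < k" "k \<noteq> i" using sw sorted_wrt_nth_less[OF sw, of i k] by auto
    then show "a \<in> (\<lambda>k. ?xs ! k) ` {..<i}" using k by auto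
  next
    fix a assume "a \<in> (\<lambda>k. ?xs ! k) ` {..<i}"
    then show "a \<in> {a \<in> I. a < ?xs ! i}"
      using sorted_wrt_nth_less[OF sw] assms len set nth_mem[of _ ?xs] by auto
  qed
  moreover have "inj_on (\<lambda>k. ?xs ! k) {..<i}"
    using assms len by (intro inj_on_nth) auto
  ultimately show ?thesis by (simp add: card_image)
qed

lemma pick_eq_nth:
  assumes "finite I" "i < card I"
  shows "pick I i = sorted_list_of_set I ! i"
proof -
  have "sorted_list_of_set I ! i \<in> I"
    using assms nth_mem[of i "sorted_list_of_set I"] by simp
  from pick_card_in_set[OF this] show ?thesis
    using card_less_nth_sorted_list[OF assms] by simp
qed

text \<open>Rows are listed with order and repetition, unlike the index sets of
  \<open>plucker\<close>. Exchanging a row is then a list update, and signs appear only on return to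
  the sorted order.\<close>

definition rows_mat :: "nat \<Rightarrow> 'a mat \<Rightarrow> nat list \<Rightarrow> 'a mat" where
  "rows_mat n A xs = mat n n (\<lambda>(i, j). A $$ (xs ! i, j))"

lemma rows_mat_carrier [simp]: "rows_mat n A xs \<in> carrier_mat n n"
  by (simp add: rows_mat_def)

lemma nsets_iff: "I \<in> nsets A n \<longleftrightarrow> I \<subseteq> A \<and> finite I \<and> card I = n"
  by (auto simp: nsets_def)

lemma plucker_eq_det_rows:
  assumes "I \<in> nsets {..<m} n" "A \<in> carrier_mat m n"
  shows "plucker n m A I = det (rows_mat n A (sorted_list_of_set I))"
proof -
  have I: "finite I" "card I = n" "{i. i < m \<and> i \<in> I} = I" using assms(1) by (auto simp: nsets_iff)
  have "submatrix A I UNIV = rows_mat n A (sorted_list_of_set I)"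
    using assms(2) I by (intro eq_matI) (auto simp: submatrix_def rows_mat_def pick_UNIV pick_eq_nth)
  then show ?thesis using assms(1) by (simp add: plucker_def)
qed

text \<open>The sign is chosen before \<open>A\<close>: identities between minors become polynomial
  relations only if their coefficients do not depend on the matrix.\<close>

lemma det_rows_permute:
  assumes "distinct xs" "length xs = n"
  shows "\<exists>\<epsilon>\<in>{1, - 1 :: 'a :: comm_ring_1}. \<forall>A. det (rows_mat n A xs) = \<epsilon> * det (rows_mat n A (sorted_list_of_set (set xs)))"
proof -
  let ?ys = "sorted_list_of_set (set xs)"
  have len: "length ?ys = n" using assms by (simp add: distinct_card)
  have "mset xs = mset ?ys" using assms(1) by (simp flip: mset_set_set)
  then obtain p where p: "p permutes {..<length ?ys}" "permute_list p ?ys = xs"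
    by (rule mset_eq_permutation)
  have p': "p permutes {0..<n}" using p(1) len by (simp add: atLeast0LessThan)
  have "det (rows_mat n A xs) = signof p * det (rows_mat n A ?ys)" for A :: "'a mat"
  proof -
    have "rows_mat n A xs = mat n n (\<lambda>(i, j). rows_mat n A ?ys $$ (p i, j))"
    proof (rule eq_matI)
      fix i j assume "i < dim_row (mat n n (\<lambda>(i, j). rows_mat n A ?ys $$ (p i, j)))"
        "j < dim_col (mat n n (\<lambda>(i, j). rows_mat n A ?ys $$ (p i, j)))"
      then have ij: "i < n" "j < n" by auto
      then have "p i < n" using permutes_in_image[OF p', of i] by simp
      moreover have "xs ! i = ?ys ! p i"
        using permute_list_nth[OF p(1), of i] p(2) ij len by simp
      ultimately show "rows_mat n A xs $$ (i, j) = mat n n (\<lambda>(i, j). rows_mat n A ?ys $$ (p i, j)) $$ (i, j)"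
        using ij by (simp add: rows_mat_def)
    qed (auto simp: rows_mat_def)
    then show ?thesis using det_permute_rows[OF rows_mat_carrier p', of A ?ys] by simp
  qed
  moreover have "signof p \<in> {1, - 1 :: 'a}" by (simp add: sign_def)
  ultimately show ?thesis by (intro bexI[of _ "signof p"]) auto
qed

lemma det_rows_eq_0:
  assumes "length xs = n" "\<not> distinct xs"
  shows "det (rows_mat n A xs :: 'a :: comm_ring_1 mat) = 0"
proof -
  obtain i j where "i < n" "j < n" "i \<noteq> j" "xs ! i = xs ! j"
    using assms by (auto simp: distinct_conv_nth)
  then show ?thesis
    by (intro det_identical_rows[of _ n i j]) (auto simp: rows_mat_def intro!: eq_vecI)
qed

lemma det_rows_scale:
  fixes A :: "'a :: comm_ring_1 mat"
  assumes "A \<in> carrier_mat m n" "length xs = n" "set xs \<subseteq> {..<m}"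
  shows "det (rows_mat n (mat_diag m t * A) xs) = (\<Prod>i<n. t (xs ! i)) * det (rows_mat n A xs)"
proof -
  have lt: "xs ! i < m" if "i < n" for i using assms that nth_mem by blast
  have "det (rows_mat n (mat_diag m t * A) xs) = (\<Sum>p | p permutes {0..<n}. signof p *
      (\<Prod>i = 0..<n. t (xs ! i) * A $$ (xs ! i, p i)))"
    unfolding det_def'[OF rows_mat_carrier]
  proof (intro sum.cong arg_cong2[of _ _ _ _ "(*)"] prod.cong refl)
    fix p i assume "p \<in> {p. p permutes {0..<n}}" "i \<in> {0..<n}"
    then have "p i < n" "i < n" using permutes_in_image[of p "{0..<n}" i] by auto
    then show "rows_mat n (mat_diag m t * A) xs $$ (i, p i) = t (xs ! i) * A $$ (xs ! i, p i)"
      using assms(1) lt by (simp add: rows_mat_def mat_diag_mult_left)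
  qed
  also have "\<dots> = (\<Prod>i<n. t (xs ! i)) * (\<Sum>p | p permutes {0..<n}. signof p * (\<Prod>i = 0..<n. A $$ (xs ! i, p i)))"
    unfolding sum_distrib_left by (auto simp: prod.distrib atLeast0LessThan intro!: sum.cong)
  also have "(\<Sum>p | p permutes {0..<n}. signof p * (\<Prod>i = 0..<n. A $$ (xs ! i, p i))) = det (rows_mat n A xs)"
    unfolding det_def'[OF rows_mat_carrier]
  proof (intro sum.cong arg_cong2[of _ _ _ _ "(*)"] prod.cong refl)
    fix p i assume "p \<in> {p. p permutes {0..<n}}" "i \<in> {0..<n}"
    then have "p i < n" "i < n" using permutes_in_image[of p "{0..<n}" i] by auto
    then show "A $$ (xs ! i, p i) = rows_mat n A xs $$ (i, p i)" by (simp add: rows_mat_def)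
  qed
  finally show ?thesis .
qed

text \<open>Linearity in row \<open>p\<close>: the cofactors along this row do not see its
  entries.\<close>

lemma det_rows_update:
  fixes A :: "'a :: comm_ring_1 mat"
  assumes "length xs = n" "p < n"
  shows "det (rows_mat n A (xs[p := x])) = (\<Sum>j<n. A $$ (x, j) * cofactor (rows_mat n A xs) p j)"
proof -
  have "det (rows_mat n A (xs[p := x]))
      = (\<Sum>j<n. rows_mat n A (xs[p := x]) $$ (p, j) * cofactor (rows_mat n A (xs[p := x])) p j)"
    by (rule laplace_expansion_row) (use assms in auto)
  also have "\<dots> = (\<Sum>j<n. A $$ (x, j) * cofactor (rows_mat n A xs) p j)"
  proof (intro sum.cong arg_cong2[of _ _ _ _ "(*)"] refl)
    fix j assume "j \<in> {..<n}"
    then show "rows_mat n A (xs[p := x]) $$ (p, j) = A $$ (x, j)" using assms by (simp add: rows_mat_def)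
    have "mat_delete (rows_mat n A (xs[p := x])) p j = mat_delete (rows_mat n A xs) p j"
      using assms by (intro eq_matI) (auto simp: mat_delete_def rows_mat_def)
    then show "cofactor (rows_mat n A (xs[p := x])) p j = cofactor (rows_mat n A xs) p j"
      by (simp add: cofactor_def)
  qed
  finally show ?thesis .
qed

text \<open>Cramer's rule without division, read off from the adjugate matrix, so that it also
  covers dependent rows \<open>ys\<close>.\<close>

lemma cramer_rows:
  fixes A :: "'a :: comm_ring_1 mat"
  assumes "length ys = n" "j < n"
  shows "A $$ (x, j) * det (rows_mat n A ys) = (\<Sum>k<n. det (rows_mat n A (ys[k := x])) * A $$ (ys ! k, j))"
proof -
  let ?M = "rows_mat n A ys"
  have "(\<Sum>k<n. det (rows_mat n A (ys[k := x])) * A $$ (ys ! k, j))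
      = (\<Sum>k<n. \<Sum>l<n. A $$ (x, l) * cofactor ?M k l * A $$ (ys ! k, j))"
    using assms by (intro sum.cong) (auto simp: det_rows_update sum_distrib_right)
  also have "\<dots> = (\<Sum>l<n. \<Sum>k<n. A $$ (x, l) * cofactor ?M k l * A $$ (ys ! k, j))"
    by (rule sum.swap)
  also have "\<dots> = (\<Sum>l<n. A $$ (x, l) * (adj_mat ?M * ?M) $$ (l, j))"
    using assms(2) by (intro sum.cong)
      (auto simp: adj_mat_def scalar_prod_def sum_distrib_left atLeast0LessThan rows_mat_def ac_simps intro!: sum.cong)
  also have "\<dots> = (\<Sum>l<n. A $$ (x, l) * (det ?M * (if l = j then 1 else 0)))"
    using assms(2) by (intro sum.cong) (auto simp: adj_mat(3)[OF rows_mat_carrier])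
  also have "\<dots> = A $$ (x, j) * det ?M"
    using assms(2) by (simp add: if_distrib sum.delta cong: if_cong)
  finally show ?thesis ..
qed

text \<open>Expand the first determinant along row \<open>p\<close> and insert the Cramer
  combination of the rows \<open>ys\<close> for row \<open>xs ! p\<close>.\<close>

lemma pluecker_relation_rows:
  fixes A :: "'a :: comm_ring_1 mat"
  assumes "length xs = n" "length ys = n" "p < n"
  shows "det (rows_mat n A xs) * det (rows_mat n A ys)
    = (\<Sum>k<n. det (rows_mat n A (xs[p := ys ! k])) * det (rows_mat n A (ys[k := xs ! p])))"
proof -
  let ?x = "xs ! p"
  have "det (rows_mat n A xs) = (\<Sum>j<n. A $$ (?x, j) * cofactor (rows_mat n A xs) p j)"
    using det_rows_update[OF assms(1,3), of A ?x] by simp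
  then have "det (rows_mat n A xs) * det (rows_mat n A ys)
    = (\<Sum>j<n. cofactor (rows_mat n A xs) p j * (A $$ (?x, j) * det (rows_mat n A ys)))"
    by (simp add: sum_distrib_left sum_distrib_right ac_simps)
  also have "\<dots> = (\<Sum>j<n. \<Sum>k<n. cofactor (rows_mat n A xs) p j * (det (rows_mat n A (ys[k := ?x])) * A $$ (ys ! k, j)))"
    using assms(2) by (intro sum.cong refl) (simp add: cramer_rows sum_distrib_left)
  also have "\<dots> = (\<Sum>k<n. \<Sum>j<n. cofactor (rows_mat n A xs) p j * (det (rows_mat n A (ys[k := ?x])) * A $$ (ys ! k, j)))"
    by (rule sum.swap)
  also have "\<dots> = (\<Sum>k<n. det (rows_mat n A (xs[p := ys ! k])) * det (rows_mat n A (ys[k := ?x])))"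
    using assms by (intro sum.cong refl) (simp add: det_rows_update[OF assms(1,3)] sum_distrib_left sum_distrib_right ac_simps)
  finally show ?thesis .
qed

lemma det_rows_plucker:
  assumes "distinct xs" "length xs = n" "set xs \<subseteq> {..<m}"
  shows "\<exists>\<epsilon>\<in>{1, - 1}. \<forall>A\<in>carrier_mat m n. det (rows_mat n A xs) = \<epsilon> * plucker n m A (set xs)"
proof -
  have "set xs \<in> nsets {..<m} n" using assms by (auto simp: nsets_iff distinct_card)
  then show ?thesis
    using det_rows_permute[OF assms(1,2), where 'a = complex] by (auto simp: plucker_eq_det_rows)
qed

text \<open>The relation has two readings: at a single matrix it gives symmetric exchange of bases,
  and as a polynomial it is a quadric vanishing on the Grassmannian. Terms with
  \<open>b \<in> I\<close> repeat a row and drop out.\<close>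

lemma plucker_exchange:
  assumes I: "I \<in> nsets {..<m} n" and B: "B \<in> nsets {..<m} n" and i: "i \<in> I - B"
  shows "\<exists>\<eta>. \<forall>A\<in>carrier_mat m n. plucker n m A I * plucker n m A B
    = (\<Sum>b\<in>B - I. \<eta> b * (plucker n m A (insert b (I - {i})) * plucker n m A (insert i (B - {b}))))"
proof -
  let ?xs = "sorted_list_of_set I" and ?ys = "sorted_list_of_set B"
  have fin: "finite I" "finite B" and sub: "I \<subseteq> {..<m}" "B \<subseteq> {..<m}" and card: "card I = n" "card B = n"
    using I B by (auto simp: nsets_iff)
  have xs: "set ?xs = I" "distinct ?xs" "length ?xs = n" and ys: "set ?ys = B" "distinct ?ys" "length ?ys = n"
    using fin card by auto
  obtain p where p: "p < n" "?xs ! p = i" using i xs by (metis DiffD1 in_set_conv_nth)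
  have bij: "bij_betw (\<lambda>k. ?ys ! k) {..<n} B" using ys by (metis bij_betw_nth)
  have ex: "\<exists>\<eta>. \<forall>A\<in>carrier_mat m n. det (rows_mat n A (?xs[p := b])) * det (rows_mat n A (?ys[k := i]))
      = \<eta> * (plucker n m A (insert b (I - {i})) * plucker n m A (insert i (B - {b})))"
    if k: "k < n" and b: "b = ?ys ! k" "b \<in> B - I" for k b
  proof -
    have x: "set (?xs[p := b]) = insert b (I - {i})" "distinct (?xs[p := b])"
      using xs p b by (simp_all add: set_update_distinct distinct_list_update)
    have y: "set (?ys[k := i]) = insert i (B - {b})" "distinct (?ys[k := i])"
      using ys k b i by (simp_all add: set_update_distinct distinct_list_update)
    have "\<exists>\<epsilon>\<in>{1, - 1}. \<forall>A\<in>carrier_mat m n. det (rows_mat n A (?xs[p := b])) = \<epsilon> * plucker n m A (insert b (I - {i}))"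
      using det_rows_plucker[of "?xs[p := b]" n m] x sub b xs by auto
    moreover have "\<exists>\<epsilon>\<in>{1, - 1}. \<forall>A\<in>carrier_mat m n. det (rows_mat n A (?ys[k := i])) = \<epsilon> * plucker n m A (insert i (B - {b}))"
      using det_rows_plucker[of "?ys[k := i]" n m] y sub i ys by auto
    ultimately obtain \<epsilon> \<delta> where
      "\<forall>A\<in>carrier_mat m n. det (rows_mat n A (?xs[p := b])) = \<epsilon> * plucker n m A (insert b (I - {i}))"
      "\<forall>A\<in>carrier_mat m n. det (rows_mat n A (?ys[k := i])) = \<delta> * plucker n m A (insert i (B - {b}))" by blast
    then show ?thesis by (intro exI[of _ "\<epsilon> * \<delta>"]) simp
  qed
  have "\<forall>b\<in>B - I. \<exists>\<eta>. \<forall>k<n. b = ?ys ! k \<longrightarrow> (\<forall>A\<in>carrier_mat m n.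
      det (rows_mat n A (?xs[p := b])) * det (rows_mat n A (?ys[k := i]))
      = \<eta> * (plucker n m A (insert b (I - {i})) * plucker n m A (insert i (B - {b}))))"
  proof
    fix b assume b: "b \<in> B - I"
    then obtain k where k: "k < n" "b = ?ys ! k" using ys by (metis DiffD1 in_set_conv_nth)
    have "k' = k" if "k' < n" "b = ?ys ! k'" for k'
      using that k ys nth_eq_iff_index_eq by metis
    with ex[OF k b] show "\<exists>\<eta>. \<forall>k<n. b = ?ys ! k \<longrightarrow> (\<forall>A\<in>carrier_mat m n.
      det (rows_mat n A (?xs[p := b])) * det (rows_mat n A (?ys[k := i]))
      = \<eta> * (plucker n m A (insert b (I - {i})) * plucker n m A (insert i (B - {b}))))" by metis
  qed
  then obtain \<eta> where \<eta>: "\<And>b k A. b \<in> B - I \<Longrightarrow> k < n \<Longrightarrow> b = ?ys ! k \<Longrightarrow> A \<in> carrier_mat m n \<Longrightarrow>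
      det (rows_mat n A (?xs[p := b])) * det (rows_mat n A (?ys[k := i]))
      = \<eta> b * (plucker n m A (insert b (I - {i})) * plucker n m A (insert i (B - {b})))" by metis
  have "plucker n m A I * plucker n m A B
    = (\<Sum>b\<in>B - I. \<eta> b * (plucker n m A (insert b (I - {i})) * plucker n m A (insert i (B - {b}))))"
    if A: "A \<in> carrier_mat m n" for A
  proof -
    have "plucker n m A I * plucker n m A B = (\<Sum>k<n. det (rows_mat n A (?xs[p := ?ys ! k])) * det (rows_mat n A (?ys[k := i])))"
      using pluecker_relation_rows[OF xs(3) ys(3) p(1), of A] p(2) A I B by (simp add: plucker_eq_det_rows)
    also have "\<dots> = (\<Sum>k<n. (\<lambda>b. if b \<in> I then 0 else
        \<eta> b * (plucker n m A (insert b (I - {i})) * plucker n m A (insert i (B - {b})))) (?ys ! k))"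
    proof (intro sum.cong refl)
      fix k assume "k \<in> {..<n}"
      then have k: "k < n" and kB: "?ys ! k \<in> B" using ys nth_mem by auto
      show "det (rows_mat n A (?xs[p := ?ys ! k])) * det (rows_mat n A (?ys[k := i]))
        = (\<lambda>b. if b \<in> I then 0 else
          \<eta> b * (plucker n m A (insert b (I - {i})) * plucker n m A (insert i (B - {b})))) (?ys ! k)"
      proof (cases "?ys ! k \<in> I")
        case True
        then obtain q where q: "q < n" "?xs ! q = ?ys ! k" using xs by (metis in_set_conv_nth)
        have "q \<noteq> p" using q p kB i by auto
        then have "?xs[p := ?ys ! k] ! q = ?xs[p := ?ys ! k] ! p" using q p xs(3) by simp
        then have "\<not> distinct (?xs[p := ?ys ! k])"
          using \<open>q \<noteq> p\<close> q(1) p(1) xs(3) nth_eq_iff_index_eq[of "?xs[p := ?ys ! k]" q p] by auto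
        then have "det (rows_mat n A (?xs[p := ?ys ! k])) = 0"
          using xs(3) by (intro det_rows_eq_0) auto
        then show ?thesis using True by simp
      next
        case False
        then show ?thesis using \<eta>[of "?ys ! k" k A] k kB A by simp
      qed
    qed
    also have "\<dots> = (\<Sum>b\<in>B. if b \<in> I then 0 else
        \<eta> b * (plucker n m A (insert b (I - {i})) * plucker n m A (insert i (B - {b}))))"
      by (rule sum.reindex_bij_betw[OF bij])
    also have "\<dots> = (\<Sum>b\<in>B - I. \<eta> b * (plucker n m A (insert b (I - {i})) * plucker n m A (insert i (B - {b}))))"
      using fin by (intro sum.mono_neutral_cong_right) auto
    finally show ?thesis .
  qed
  then show ?thesis by blast
qed

lemma plucker_torus:
  assumes "A \<in> carrier_mat m n"
  shows "plucker n m (mat_diag m t * A) I = (\<Prod>i\<in>I. t i) * plucker n m A I"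
proof (cases "I \<in> nsets {..<m} n")
  case True
  then have I: "finite I" "I \<subseteq> {..<m}" "card I = n" by (auto simp: nsets_iff)
  let ?xs = "sorted_list_of_set I"
  have xs: "set ?xs = I" "distinct ?xs" "length ?xs = n" using I by auto
  have "bij_betw (\<lambda>k. ?xs ! k) {..<n} I" using xs by (metis bij_betw_nth)
  then have "(\<Prod>i<n. t (?xs ! i)) = (\<Prod>i\<in>I. t i)" by (rule prod.reindex_bij_betw)
  then show ?thesis
    using plucker_eq_det_rows[OF True, of "mat_diag m t * A"] plucker_eq_det_rows[OF True assms]
      det_rows_scale[OF assms xs(3), of t] xs(1) I(2) assms by (simp add: mult_carrier_mat[OF mat_diag_dim])
qed (simp add: plucker_def)

text \<open>Laplace expansion along the constant first column \<open>s e\<close>. The vanishing last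
  row of \<open>C\<close> means that its columns involve only the first \<open>m - 1\<close> unit
  vectors, the basis of the quotient by \<open>e\<close> behind \<open>wedge_e\<close>.\<close>

lemma plucker_eq_wedge_e:
  assumes A: "A \<in> carrier_mat m (Suc k)" and C: "C \<in> carrier_mat m k"
    and s: "\<And>i. i < m \<Longrightarrow> A $$ (i, 0) = s" and AC: "\<And>i j. i < m \<Longrightarrow> j < k \<Longrightarrow> A $$ (i, Suc j) = C $$ (i, j)"
    and last: "\<And>j. j < k \<Longrightarrow> C $$ (m - 1, j) = 0"
    and I: "I \<in> nsets {..<m} (Suc k)"
  shows "plucker (Suc k) m A I = poly_eval (wedge_e m I) (\<lambda>J. s * plucker k m C J)"
proof -
  let ?xs = "sorted_list_of_set I"
  have fin: "finite I" "I \<subseteq> {..<m}" "card I = Suc k" using I by (auto simp: nsets_iff)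
  have xs: "set ?xs = I" "distinct ?xs" "length ?xs = Suc k" using fin by auto
  have lt: "?xs ! i < m" if "i < Suc k" for i
    using nth_mem[of i ?xs] that xs fin(2) by auto
  have bij: "bij_betw (\<lambda>i. ?xs ! i) {..<Suc k} I" using xs by (metis bij_betw_nth)
  have sub: "I - {i} \<in> nsets {..<m} k" if "i \<in> I" for i using that fin by (auto simp: nsets_iff)
  let ?g = "\<lambda>i. (- 1) ^ card {l \<in> I. l < i} * (s * plucker k m C (I - {i}))"
  \<comment> \<open>Minors through the zero row \<open>m - 1\<close> vanish, matching the terms that
    \<open>wedge_e\<close> omits.\<close>
  have zero: "plucker k m C (I - {i}) = 0" if i: "i \<in> I" "m - 1 \<in> I - {i}" for i
  proof -
    let ?ys = "sorted_list_of_set (I - {i})"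
    have ys: "set ?ys = I - {i}" "length ?ys = k" using sub[OF i(1)] by (auto simp: nsets_iff)
    then obtain q where q: "q < k" "?ys ! q = m - 1" using i(2) by (metis in_set_conv_nth)
    have "det (rows_mat k C ?ys) = (\<Sum>j<k. rows_mat k C ?ys $$ (q, j) * cofactor (rows_mat k C ?ys) q j)"
      by (rule laplace_expansion_row) (use q in auto)
    also have "\<dots> = 0" using q last by (intro sum.neutral) (auto simp: rows_mat_def)
    finally show ?thesis using sub[OF i(1)] C by (simp add: plucker_eq_det_rows)
  qed
  have "plucker (Suc k) m A I = (\<Sum>i<Suc k. rows_mat (Suc k) A ?xs $$ (i, 0) * cofactor (rows_mat (Suc k) A ?xs) i 0)"
    unfolding plucker_eq_det_rows[OF I A] by (rule laplace_expansion_column) auto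
  also have "\<dots> = (\<Sum>i<Suc k. ?g (?xs ! i))"
  proof (intro sum.cong refl)
    fix i assume "i \<in> {..<Suc k}"
    then have i: "i < Suc k" by simp
    let ?ys = "sorted_list_of_set (I - {?xs ! i})"
    have iI: "?xs ! i \<in> I" using nth_mem[of i ?xs] i xs by simp
    have "?ys = remove1 (?xs ! i) ?xs" using fin by (simp add: sorted_list_of_set_remove)
    also have "\<dots> = take i ?xs @ drop (Suc i) ?xs"
    proof -
      have *: "?xs = take i ?xs @ ?xs ! i # drop (Suc i) ?xs" using i xs(3) by (simp add: id_take_nth_drop)
      then have "?xs ! i \<notin> set (take i ?xs)" using xs(2) distinct_append[of "take i ?xs" "?xs ! i # drop (Suc i) ?xs"] by auto
      then have "remove1 (?xs ! i) (take i ?xs @ ?xs ! i # drop (Suc i) ?xs) = take i ?xs @ drop (Suc i) ?xs"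
        by (simp add: remove1_append)
      then show ?thesis by (simp flip: *)
    qed
    finally have ys: "?ys = take i ?xs @ drop (Suc i) ?xs" .
    have nth: "?ys ! a = ?xs ! (if a < i then a else Suc a)" if "a < k" for a
      unfolding ys using that i xs(3) by (auto simp: nth_append)
    have "mat_delete (rows_mat (Suc k) A ?xs) i 0 = rows_mat k C ?ys"
      using i AC lt by (intro eq_matI) (auto simp: mat_delete_def rows_mat_def nth)
    then have "cofactor (rows_mat (Suc k) A ?xs) i 0 = (- 1) ^ i * plucker k m C (I - {?xs ! i})"
      using plucker_eq_det_rows[OF sub[OF iI] C] by (simp add: cofactor_def)
    moreover have "card {l \<in> I. l < ?xs ! i} = i" using card_less_nth_sorted_list fin i by simp
    moreover have "rows_mat (Suc k) A ?xs $$ (i, 0) = s" using i s lt by (simp add: rows_mat_def)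
    ultimately show "rows_mat (Suc k) A ?xs $$ (i, 0) * cofactor (rows_mat (Suc k) A ?xs) i 0 = ?g (?xs ! i)"
      by simp
  qed
  also have "\<dots> = (\<Sum>i\<in>I. ?g i)" by (rule sum.reindex_bij_betw[OF bij])
  also have "\<dots> = (\<Sum>i | i \<in> I \<and> m - 1 \<notin> I - {i}. ?g i)"
    using fin zero by (intro sum.mono_neutral_right) auto
  also have "\<dots> = poly_eval (wedge_e m I) (\<lambda>J. s * plucker k m C J)"
    by (simp add: wedge_e_def eval.subst_simps)
  finally show ?thesis .
qed

text \<open>In the chart of \<open>K\<close> a point of \<open>Gr(k, m - 1)\<close> is a matrix with
  identity block in the rows \<open>K\<close>. Its other entries are, up to sign and division by the
  coordinate at \<open>K\<close>, the coordinates at the neighbours of \<open>K\<close>, which are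
  therefore free.\<close>

lemma sub_grassmannian_free_coordinates:
  fixes \<tau> :: "nat set \<Rightarrow> complex"
  assumes K: "K \<in> nsets {..<m - 1} k" and m: "0 < m" and \<tau>: "\<forall>J. \<tau> J \<noteq> 0"
  shows "\<exists>x\<in>sub_grassmannian (Suc k) m. \<exists>\<omega>.
    (\<forall>I\<in>nsets {..<m} (Suc k). x I = poly_eval (wedge_e m I) \<omega>) \<and> \<omega> K = \<tau> K \<and>
    (\<forall>b\<in>K. \<forall>c\<in>{..<m - 1} - K. \<omega> (insert c (K - {b})) = \<tau> (insert c (K - {b})))"
proof -
  let ?ks = "sorted_list_of_set K"
  have fin: "finite K" "K \<subseteq> {..<m - 1}" "card K = k" using K by (auto simp: nsets_iff)
  have ks: "set ?ks = K" "distinct ?ks" "length ?ks = k" using fin by auto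
  have "\<exists>\<epsilon>\<in>{1, - 1}. \<forall>A\<in>carrier_mat m k. det (rows_mat k A (?ks[j := c])) = \<epsilon> * plucker k m A (insert c (K - {?ks ! j}))"
    if "j < k" "c \<in> {..<m - 1} - K" for j c
  proof -
    have "set (?ks[j := c]) = insert c (K - {?ks ! j})" "distinct (?ks[j := c])"
      using that ks by (simp_all add: set_update_distinct distinct_list_update)
    moreover have "insert c (K - {?ks ! j}) \<subseteq> {..<m}" using that fin by auto
    ultimately show ?thesis using det_rows_plucker[of "?ks[j := c]" k m] ks(3) by simp
  qed
  then obtain \<epsilon> where \<epsilon>: "\<And>j c. j < k \<Longrightarrow> c \<in> {..<m - 1} - K \<Longrightarrow> \<epsilon> j c \<in> {1, - 1}"
    "\<And>j c A. j < k \<Longrightarrow> c \<in> {..<m - 1} - K \<Longrightarrow> A \<in> carrier_mat m k \<Longrightarrow>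
      det (rows_mat k A (?ks[j := c])) = \<epsilon> j c * plucker k m A (insert c (K - {?ks ! j}))"
    by metis
  \<comment> \<open>Identity in the rows \<open>K\<close>, zero in the last row as
    \<open>plucker_eq_wedge_e\<close> requires, and the prescribed values elsewhere, with the signs
    \<open>\<epsilon>\<close> that arise from sorting after a row has been replaced.\<close>
  define C where "C = mat m k (\<lambda>(r, j). if r \<in> K then (if ?ks ! j = r then 1 else 0)
    else if r = m - 1 then 0 else \<epsilon> j r * \<tau> (insert r (K - {?ks ! j})) / \<tau> K)"
  \<comment> \<open>With first column \<open>\<tau> K\<close> times \<open>e\<close> the column
    space still contains \<open>e\<close>, and \<open>\<omega>\<close> acquires the factor that
    makes its value at \<open>K\<close> equal to \<open>\<tau> K\<close>.\<close>
  define A where "A = mat m (Suc k) (\<lambda>(r, j). if j = 0 then \<tau> K else C $$ (r, j - 1))"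
  define \<omega> where "\<omega> J = \<tau> K * plucker k m C J" for J
  have C: "C \<in> carrier_mat m k" and A: "A \<in> carrier_mat m (Suc k)" by (auto simp: C_def A_def)
  have Km: "K \<in> nsets {..<m} k" using K by (auto simp: nsets_iff)
  have ksK: "?ks ! i \<in> K" if "i < k" for i using that ks nth_mem by blast
  have lt: "?ks ! i < m" "?ks ! i < m - 1" if "i < k" for i using ksK[OF that] fin by auto
  have C_ks: "C $$ (?ks ! i, j) = (if i = j then 1 else 0)" if "i < k" "j < k" for i j
    using that ksK lt ks nth_eq_iff_index_eq[of ?ks j i] by (auto simp: C_def)
  have "rows_mat k C ?ks = 1\<^sub>m k" by (rule eq_matI) (auto simp: rows_mat_def C_ks)
  then have det1: "det (rows_mat k C ?ks) = 1" by simp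
  then have \<omega>K: "\<omega> K = \<tau> K" using Km C by (simp add: \<omega>_def plucker_eq_det_rows)
  have \<omega>nb: "\<omega> (insert c (K - {b})) = \<tau> (insert c (K - {b}))" if b: "b \<in> K" and c: "c \<in> {..<m - 1} - K" for b c
  proof -
    obtain j where j: "j < k" "b = ?ks ! j" using b ks by (metis in_set_conv_nth)
    \<comment> \<open>Cramer's rule against the identity block turns the entry into the minor of the
      neighbour.\<close>
    have "C $$ (c, j) = (\<Sum>i<k. det (rows_mat k C (?ks[i := c])) * C $$ (?ks ! i, j))"
      using cramer_rows[OF ks(3) j(1), of C c] det1 by simp
    also have "\<dots> = (\<Sum>i<k. if i = j then det (rows_mat k C (?ks[i := c])) else 0)"
      using j by (intro sum.cong) (auto simp: C_ks)
    also have "\<dots> = \<epsilon> j c * plucker k m C (insert c (K - {b}))"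
      using j c C \<epsilon>(2) by simp
    finally have "\<epsilon> j c * plucker k m C (insert c (K - {b})) = C $$ (c, j)" ..
    also have "\<dots> = \<epsilon> j c * \<tau> (insert c (K - {b})) / \<tau> K" using c j by (auto simp: C_def)
    finally have "plucker k m C (insert c (K - {b})) = \<tau> (insert c (K - {b})) / \<tau> K"
      using \<epsilon>(1)[OF j(1) c] by auto
    then show ?thesis using \<tau> by (simp add: \<omega>_def)
  qed
  have x: "plucker (Suc k) m A I = poly_eval (wedge_e m I) \<omega>" if "I \<in> nsets {..<m} (Suc k)" for I
    unfolding \<omega>_def using that fin(2) m
    by (intro plucker_eq_wedge_e[OF A C]) (auto simp: A_def C_def)
  \<comment> \<open>The minor at this set is \<open>\<tau> K\<close> up to sign, which certifies
    full rank.\<close>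
  define B where "B = insert (m - 1) K"
  have mK: "m - 1 \<notin> K" using fin by auto
  have B: "B \<in> nsets {..<m} (Suc k)" using fin mK m by (auto simp: B_def nsets_iff)
  have "{i \<in> B. m - 1 \<notin> B - {i}} = {m - 1}" by (auto simp: B_def)
  moreover have "B - {m - 1} = K" using mK by (auto simp: B_def)
  ultimately have "plucker (Suc k) m A B = (- 1) ^ card {l \<in> B. l < m - 1} * \<tau> K"
    unfolding x[OF B] by (simp add: wedge_e_def eval.subst_simps \<omega>K)
  then have "det (submatrix A B UNIV) \<noteq> 0" using \<tau> B by (simp add: plucker_def)
  from vec_space.rank_gt_minor[OF A this] have "Suc k \<le> vec_space.rank m A" by simp
  then have rank: "vec_space.rank m A = Suc k" using vec_space.rank_le_nc[OF A] by simp
  have e: "vec m (\<lambda>_. 1) = A *\<^sub>v (vec (Suc k) (\<lambda>j. if j = 0 then 1 / \<tau> K else 0))"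
  proof (rule eq_vecI)
    fix i assume "i < dim_vec (A *\<^sub>v vec (Suc k) (\<lambda>j. if j = 0 then 1 / \<tau> K else 0))"
    then have i: "i < m" using A by simp
    have "(A *\<^sub>v vec (Suc k) (\<lambda>j. if j = 0 then 1 / \<tau> K else 0)) $ i
        = (\<Sum>j = 0..<Suc k. A $$ (i, j) * (if j = 0 then 1 / \<tau> K else 0))"
      using A i by (auto simp: scalar_prod_def intro!: sum.cong)
    also have "\<dots> = 1" using i \<tau> by (simp add: if_distrib sum.delta A_def cong: if_cong)
    finally show "vec m (\<lambda>_. 1) $ i = (A *\<^sub>v vec (Suc k) (\<lambda>j. if j = 0 then 1 / \<tau> K else 0)) $ i"
      using i by simp
  qed (use A in auto)
  have "vec m (\<lambda>_. 1) \<in> vec_space.col_space m A"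
    using e A unfolding vec_space.col_space_eq[OF A] by (auto intro!: exI[of _ "vec (Suc k) (\<lambda>j. if j = 0 then 1 / \<tau> K else 0)"])
  then have "plucker (Suc k) m A \<in> sub_grassmannian (Suc k) m"
    using A rank by (auto simp: sub_grassmannian_def)
  then show ?thesis using x \<omega>K \<omega>nb by blast
qed


section \<open>Forms vanishing on a torus orbit\<close>

text \<open>Taking all quadrics of the ideal makes one inclusion automatic. The other is local on
  charts, where generators suffice because \<open>localization\<close> is an ideal.\<close>

lemma defined_by_quadricsI:
  assumes fin: "finite V" and S: "S \<subseteq> polys V"
    and loc: "\<And>f v. f \<in> S \<Longrightarrow> v \<in> V \<Longrightarrow>
      f \<in> localization V v (Idl\<^bsub>poly_ring V\<^esub> (forms V 2 \<inter> Idl\<^bsub>poly_ring V\<^esub> S))"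
  shows "defined_by_quadrics V (Idl\<^bsub>poly_ring V\<^esub> S)"
proof -
  let ?I = "Idl\<^bsub>poly_ring V\<^esub> S"
  let ?Q = "forms V 2 \<inter> ?I"
  let ?J = "Idl\<^bsub>poly_ring V\<^esub> ?Q"
  have I: "poly_ideal V ?I" using S by (rule poly_ideal_genideal)
  have J: "poly_ideal V ?J" by (rule poly_ideal_genideal) (auto dest: forms_polys)
  have JI: "?J \<subseteq> ?I" by (rule genideal_minimal_poly[OF I]) auto
  have IL: "?I \<subseteq> localization V v ?J" if "v \<in> V" for v
    using loc that by (intro genideal_minimal_poly poly_ideal_localization J) auto
  have "saturation V ?J = saturation V ?I"
  proof (intro equalityI subsetI)
    fix f assume "f \<in> saturation V ?J"
    then show "f \<in> saturation V ?I"
      unfolding saturation_iff[OF fin I] saturation_iff[OF fin J] using localization_mono[OF JI] by blast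
  next
    fix f assume f: "f \<in> saturation V ?I"
    have "f \<in> localization V v ?J" if v: "v \<in> V" for v
    proof -
      from f v obtain N where N: "f \<in> polys V" "poly_var v ^ N * f \<in> ?I"
        unfolding saturation_iff[OF fin I] localization_def by blast
      show ?thesis by (rule localization_cancel[OF N(1) subsetD[OF IL[OF v] N(2)]])
    qed
    then show "f \<in> saturation V ?J"
      using f unfolding saturation_iff[OF fin I] saturation_iff[OF fin J] by blast
  qed
  then show ?thesis unfolding defined_by_quadrics_def by (intro exI[of _ ?Q] conjI) blast+
qed

section \<open>Monomials as multisets of index sets, and the ideal of a torus orbit\<close>

definition mset_of_monom :: "('v \<Rightarrow>\<^sub>0 nat) \<Rightarrow> 'v multiset" where
  "mset_of_monom u = (\<Sum>v\<in>Poly_Mapping.keys u. replicate_mset (Poly_Mapping.lookup u v) v)"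

lemma prod_mset_of_monom:
  "prod_mset (image_mset g (mset_of_monom u)) = (\<Prod>v\<in>Poly_Mapping.keys u. g v ^ Poly_Mapping.lookup u v)"
proof -
  have "prod_mset (image_mset g (\<Sum>v\<in>A. replicate_mset (h v) v)) = (\<Prod>v\<in>A. g v ^ h v)" if "finite A" for A h
    using that by (induction rule: finite_induct) auto
  then show ?thesis by (simp add: mset_of_monom_def)
qed

lemma set_mset_of_monom: "set_mset (mset_of_monom u) = Poly_Mapping.keys u"
  by (auto simp: mset_of_monom_def set_mset_sum in_keys_iff)

lemma size_mset_of_monom: "size (mset_of_monom u) = monom_degree u"
  by (simp add: mset_of_monom_def size_multiset_sum)

lemma set_mset_ground: "(\<And>I. I \<in># U \<Longrightarrow> finite I) \<Longrightarrow> set_mset (ground U) = \<Union> (set_mset U)"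
  by (induction U) auto

lemma prod_mset_image_ground:
  "prod_mset (image_mset t (ground U)) = prod_mset (image_mset (\<lambda>I. \<Prod>i\<in>I. t i) U)"
  by (induction U) (auto simp: prod_unfold_prod_mset)

locale torus_orbit_ideal =
  fixes n m :: nat and A :: "complex mat"
  assumes A: "A \<in> carrier_mat m n"
begin

abbreviation V :: "nat set set" where "V \<equiv> nsets {..<m} n"

abbreviation p :: "nat set \<Rightarrow> complex" where "p \<equiv> plucker n m A"

definition quadrics :: "nat set cpoly set" where
  "quadrics = {q \<in> forms V 2. \<forall>x\<in>torus_orbit n m A. poly_eval q x = 0}"

abbreviation J :: "nat set cpoly set" where "J \<equiv> Idl\<^bsub>poly_ring V\<^esub> quadrics"

definition bases :: "nat set set" where "bases = {I. p I \<noteq> 0}"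

lemma bases_V: "I \<in> bases \<Longrightarrow> I \<in> V"
  by (auto simp: bases_def plucker_def split: if_splits)

lemma J: "poly_ideal V J" and quadrics_J: "quadrics \<subseteq> J"
  using poly_ideal_genideal[of quadrics V] genideal_self_poly[of quadrics V]
  by (auto simp: quadrics_def dest: forms_polys)

text \<open>A nonzero product of two minors forces a nonzero term on the other side of the Pluecker
  relation.\<close>

lemma exchange_bases: "B \<in> bases \<Longrightarrow> exchange_system bases B"
proof
  fix I J x assume IJ: "I \<in> bases" "J \<in> bases" and x: "x \<in> I - J"
  obtain \<eta> where "p I * p J = (\<Sum>y\<in>J - I. \<eta> y * (p (insert y (I - {x})) * p (insert x (J - {y}))))"
    using plucker_exchange[OF bases_V[OF IJ(1)] bases_V[OF IJ(2)] x] A by blast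
  then have "(\<Sum>y\<in>J - I. \<eta> y * (p (insert y (I - {x})) * p (insert x (J - {y})))) \<noteq> 0"
    using IJ by (auto simp: bases_def)
  then obtain y where "y \<in> J - I" "\<eta> y * (p (insert y (I - {x})) * p (insert x (J - {y}))) \<noteq> 0"
    by (rule sum.not_neutral_contains_not_neutral)
  then show "\<exists>y\<in>J - I. insert y (I - {x}) \<in> bases \<and> insert x (J - {y}) \<in> bases"
    by (auto simp: bases_def)
next
  show "finite I" if "I \<in> bases" for I using bases_V[OF that] by (simp add: nsets_iff)
qed

lemma torus_orbit_coordinates:
  "torus_orbit n m A = {\<lambda>I. (\<Prod>i\<in>I. t i) * p I | t. \<forall>i<m. t i \<noteq> 0}"
  by (auto simp: torus_orbit_def plucker_torus[OF A] fun_eq_iff)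

text \<open>The value is 0 outside \<open>V\<close> because \<open>swap_equiv\<close> also relates multisets containing non-bases.\<close>

definition normalized_var :: "nat set \<Rightarrow> nat set cpoly" where
  "normalized_var I = (if I \<in> V then poly_const (1 / p I) * poly_var I else 0)"

definition normalized_monom :: "nat set multiset \<Rightarrow> nat set cpoly" where
  "normalized_monom U = prod_mset (image_mset normalized_var U)"

lemma normalized_monom_simps [simp]:
  "normalized_monom {#} = 1" "normalized_monom (add_mset I U) = normalized_var I * normalized_monom U"
  "normalized_monom (U + W) = normalized_monom U * normalized_monom W"
  by (auto simp: normalized_monom_def)

lemma normalized_var_polys: "normalized_var I \<in> polys V"
  by (auto simp: normalized_var_def intro: polys_mult polys_var)

lemma normalized_monom_polys: "normalized_monom U \<in> polys V"
  by (induction U) (auto intro: polys_mult normalized_var_polys)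

text \<open>The purpose of dividing by \<open>p I\<close>: on the orbit, a monomial in bases becomes
  a character that depends only on the union, so that each swap gives a binomial with coefficients 1
  and -1.\<close>

lemma eval_normalized_monom:
  "set_mset U \<subseteq> bases \<Longrightarrow>
    poly_eval (normalized_monom U) (\<lambda>I. (\<Prod>i\<in>I. t i) * p I) = prod_mset (image_mset t (ground U))"
proof (induction U)
  case (add I U)
  then have I: "p I \<noteq> 0" "I \<in> V" using bases_V by (auto simp: bases_def)
  then show ?case using add by (simp add: normalized_var_def eval.subst_simps prod_unfold_prod_mset)
qed simp

text \<open>Each rule of \<open>swap_equiv\<close> is a closure property of the localized ideal:
  \<open>swap\<close> supplies a quadric vanishing on the orbit, and \<open>equiv_cancel\<close>
  divides by the coordinate at \<open>B\<close>.\<close>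

lemma swap_equiv_localization:
  assumes "swap_equiv bases B U W" and B: "B \<in> bases"
  shows "normalized_monom U - normalized_monom W \<in> localization V B J"
  using assms(1)
proof (induction rule: swap_equiv.induct)
  note L = poly_ideal_localization[OF J bases_V[OF B]]
  {
    case (swap I J' K L')
    have "poly_eval (normalized_monom {#I, J'#} - normalized_monom {#K, L'#}) x = 0"
      if "x \<in> torus_orbit n m A" for x
    proof -
      obtain t where x: "x = (\<lambda>I. (\<Prod>i\<in>I. t i) * p I)" using \<open>x \<in> torus_orbit n m A\<close>
        by (auto simp: torus_orbit_coordinates)
      have "set_mset {#I, J'#} \<subseteq> bases" "set_mset {#K, L'#} \<subseteq> bases" using swap by auto
      from this[THEN eval_normalized_monom] show ?thesis
        unfolding x eval.subst_diff swap.hyps(5) by simp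
    qed
    moreover have "normalized_var I \<in> forms V 1" for I
      by (cases "I \<in> V") (simp_all add: normalized_var_def forms_const_mult forms_var del: One_nat_def)
    then have "normalized_monom {#I, J'#} - normalized_monom {#K, L'#} \<in> forms V 2"
      using forms_mult[of _ V 1 _ 1] by (auto intro!: forms_diff simp: numeral_2_eq_2)
    ultimately have "normalized_monom {#I, J'#} - normalized_monom {#K, L'#} \<in> quadrics"
      unfolding quadrics_def by blast
    then show ?case using quadrics_J subset_localization[OF J] by blast
  next
    case (equiv_refl U)
    show ?case using poly_idealD(2)[OF L] by simp
  next
    case (equiv_sym U W)
    show ?case using poly_ideal_uminus[OF L equiv_sym.IH] by simp
  next
    case (equiv_trans U W X)
    show ?case using poly_idealD(3)[OF L equiv_trans.IH] by simp
  next
    case (equiv_add U W X)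
    show ?case using poly_idealD(4)[OF L normalized_monom_polys equiv_add.IH, of X] by (simp add: algebra_simps)
  next
    case (equiv_cancel U W)
    have "poly_const (p B) * (normalized_monom (add_mset B U) - normalized_monom (add_mset B W)) \<in> localization V B J"
      by (rule poly_idealD(4)[OF L polys_const equiv_cancel.IH])
    moreover have "poly_const (p B) * normalized_var B = poly_var B"
      using B bases_V[OF B] by (simp add: normalized_var_def bases_def flip: mult.assoc poly_const_mult)
    ultimately have "poly_var B ^ 1 * (normalized_monom U - normalized_monom W) \<in> localization V B J"
      by (simp add: right_diff_distrib flip: mult.assoc)
    then show ?case by (rule localization_cancel[rotated]) (intro polys_diff normalized_monom_polys)
  }
qed

text \<open>The product with the coordinate at \<open>B\<close> is a quadric vanishing on the orbit.
  For \<open>I = B\<close> it is a square, which shows that the chart of a nonbasis is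
  empty.\<close>

lemma nonbasis_localization:
  assumes "B \<in> V" "I \<in> V" "I \<notin> bases"
  shows "poly_var I \<in> localization V B J"
proof -
  have "poly_var B * poly_var I \<in> quadrics"
    using forms_mult[OF forms_var[OF assms(1)] forms_var[OF assms(2)]] assms(3)
    by (auto simp: quadrics_def torus_orbit_coordinates eval.subst_simps bases_def numeral_2_eq_2)
  then have "poly_var B ^ 1 * poly_var I \<in> localization V B J"
    using quadrics_J subset_localization[OF J] by auto
  then show ?thesis by (rule localization_cancel[rotated]) (rule polys_var[OF assms(2)])
qed

definition weight :: "(nat set \<Rightarrow>\<^sub>0 nat) \<Rightarrow> nat multiset" where
  "weight u = ground (mset_of_monom u)"

definition value_at_p :: "(nat set \<Rightarrow>\<^sub>0 nat) \<Rightarrow> complex" where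
  "value_at_p u = (\<Prod>I\<in>Poly_Mapping.keys u. p I ^ Poly_Mapping.lookup u I)"

lemma weight_sub: "Poly_Mapping.keys u \<subseteq> V \<Longrightarrow> set_mset (weight u) \<subseteq> {..<m}"
  using set_mset_ground[of "mset_of_monom u"]
  by (fastforce simp: weight_def set_mset_of_monom nsets_iff dest: subsetD)

text \<open>The torus acts on a monomial through its weight, so that a form vanishing on the orbit vanishes
  at \<open>p\<close> in each weight separately.\<close>

lemma weight_component_value:
  assumes f: "f \<in> polys V" and van: "\<forall>x\<in>torus_orbit n m A. poly_eval f x = 0"
  shows "(\<Sum>u | u \<in> Poly_Mapping.keys f \<and> weight u = w. Poly_Mapping.lookup f u * value_at_p u) = 0"
proof (cases "w \<in> weight ` Poly_Mapping.keys f")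
  case True
  let ?W = "weight ` Poly_Mapping.keys f"
  let ?c = "\<lambda>w. \<Sum>u | u \<in> Poly_Mapping.keys f \<and> weight u = w. Poly_Mapping.lookup f u * value_at_p u"
  have sub: "set_mset w \<subseteq> {..<m}" if "w \<in> ?W" for w
    using that f weight_sub unfolding polys_iff by blast
  show ?thesis
  \<comment> \<open>The monomials here are those in the torus parameters \<open>t\<close>, with
    weights as exponents and the values at \<open>p\<close> of the weight components of
    \<open>f\<close> as coefficients.\<close>
  proof (rule monomials_independent[of "{..<m}" ?W count ?c])
    fix s t assume st: "s \<in> ?W" "t \<in> ?W" "\<forall>i\<in>{..<m}. count s i = count t i"
    show "s = t"
    proof (rule multiset_eqI)
      fix i show "count s i = count t i"
      proof (cases "i < m")
        case False
        then have "i \<notin># s" "i \<notin># t" using sub[OF st(1)] sub[OF st(2)] by auto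
        then show ?thesis by (simp add: not_in_iff)
      qed (use st(3) in simp)
    qed
  next
    fix t :: "nat \<Rightarrow> complex" assume t: "\<forall>i. t i \<noteq> 0"
    have monom: "(\<Prod>I\<in>Poly_Mapping.keys u. ((\<Prod>i\<in>I. t i) * p I) ^ Poly_Mapping.lookup u I)
        = value_at_p u * (\<Prod>i<m. t i ^ count (weight u) i)" if u: "u \<in> Poly_Mapping.keys f" for u
    proof -
      have "(\<Prod>I\<in>Poly_Mapping.keys u. (\<Prod>i\<in>I. t i) ^ Poly_Mapping.lookup u I)
          = prod_mset (image_mset (\<lambda>I. \<Prod>i\<in>I. t i) (mset_of_monom u))"
        by (simp add: prod_mset_of_monom)
      also have "\<dots> = prod_mset (image_mset t (weight u))"
        by (simp add: weight_def prod_mset_image_ground)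
      also have "\<dots> = (\<Prod>i\<in>set_mset (weight u). t i ^ count (weight u) i)"
        by (rule image_prod_mset_multiplicity)
      also have "\<dots> = (\<Prod>i<m. t i ^ count (weight u) i)"
        using sub[of "weight u"] u by (intro prod.mono_neutral_left) (auto simp: not_in_iff)
      finally show ?thesis by (simp add: power_mult_distrib prod.distrib value_at_p_def)
    qed
    have "(\<Sum>w\<in>?W. ?c w * (\<Prod>i\<in>{..<m}. t i ^ count w i))
      = (\<Sum>w\<in>?W. \<Sum>u\<in>{u \<in> Poly_Mapping.keys f. weight u = w}.
          Poly_Mapping.lookup f u * value_at_p u * (\<Prod>i<m. t i ^ count (weight u) i))"
      by (intro sum.cong) (auto simp: sum_distrib_right)
    also have "\<dots> = (\<Sum>u\<in>Poly_Mapping.keys f. Poly_Mapping.lookup f u * value_at_p u * (\<Prod>i<m. t i ^ count (weight u) i))"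
      by (intro sum.group) auto
    also have "\<dots> = poly_eval f (\<lambda>I. (\<Prod>i\<in>I. t i) * p I)"
      unfolding poly_subst_def
    proof (intro sum.cong refl)
      fix u assume "u \<in> Poly_Mapping.keys f"
      from monom[OF this] show "Poly_Mapping.lookup f u * value_at_p u * (\<Prod>i<m. t i ^ count (weight u) i)
        = Poly_Mapping.lookup f u * (\<Prod>I\<in>Poly_Mapping.keys u. ((\<Prod>i\<in>I. t i) * p I) ^ Poly_Mapping.lookup u I)"
        by (simp only: mult.assoc)
    qed
    also have "\<dots> = 0" using van t by (auto simp: torus_orbit_coordinates)
    finally show "(\<Sum>w\<in>?W. ?c w * (\<Prod>i\<in>{..<m}. t i ^ count w i)) = 0" .
  qed (use True in auto)
next
  case False
  then show ?thesis by (intro sum.neutral) auto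
qed

text \<open>A monomial containing a nonbasis is zero in the chart of \<open>B\<close>, and so is its
  value at \<open>p\<close>; both alternatives therefore have the form needed in
  \<open>vanishing_on_orbit_localization\<close>.\<close>

lemma monomial_localization:
  assumes B: "B \<in> bases" and u: "Poly_Mapping.keys u \<subseteq> V"
  shows "Poly_Mapping.keys u \<subseteq> bases \<and>
      Poly_Mapping.single u 1 = poly_const (value_at_p u) * normalized_monom (mset_of_monom u)
    \<or> value_at_p u = 0 \<and> Poly_Mapping.single u 1 \<in> localization V B J"
proof (cases "Poly_Mapping.keys u \<subseteq> bases")
  case True
  have "poly_const (value_at_p u) * normalized_monom (mset_of_monom u)
      = (\<Prod>I\<in>Poly_Mapping.keys u. (poly_const (p I) * normalized_var I) ^ Poly_Mapping.lookup u I)"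
    by (simp add: normalized_monom_def prod_mset_of_monom value_at_p_def prod.distrib power_mult_distrib
        poly_const_prod poly_const_power)
  also have "\<dots> = (\<Prod>I\<in>Poly_Mapping.keys u. poly_var I ^ Poly_Mapping.lookup u I)"
  proof (intro prod.cong refl arg_cong2[of _ _ _ _ "(^)"])
    fix I assume "I \<in> Poly_Mapping.keys u"
    then have "p I \<noteq> 0" "I \<in> V" using True u by (auto simp: bases_def)
    then show "poly_const (p I) * normalized_var I = poly_var I"
      by (simp add: normalized_var_def flip: mult.assoc poly_const_mult)
  qed
  finally show ?thesis using True by (simp add: single_monomial)
next
  case False
  then obtain I where I: "I \<in> Poly_Mapping.keys u" "I \<notin> bases" by blast
  let ?r = "poly_var I ^ (Poly_Mapping.lookup u I - 1) *
    (\<Prod>K\<in>Poly_Mapping.keys u - {I}. poly_var K ^ Poly_Mapping.lookup u K)"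
  have "poly_var I ^ Poly_Mapping.lookup u I = poly_var I * poly_var I ^ (Poly_Mapping.lookup u I - 1)"
    using I(1) by (simp add: in_keys_iff power_eq_if)
  then have "Poly_Mapping.single u 1 = ?r * poly_var I"
    unfolding single_monomial using I(1)
    by (subst prod.remove[of _ I]) (simp_all add: ac_simps)
  moreover have "?r \<in> polys V" using u I by (auto intro!: polys_mult polys_prod polys_power polys_var)
  moreover have "poly_var I \<in> localization V B J"
    using nonbasis_localization bases_V[OF B] u I by blast
  ultimately have "Poly_Mapping.single u 1 \<in> localization V B J"
    using poly_idealD(4)[OF poly_ideal_localization[OF J bases_V[OF B]]] by simp
  moreover have "value_at_p u = 0"
    using I unfolding value_at_p_def bases_def by (intro prod_zero) (auto simp: in_keys_iff intro!: bexI[of _ I])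
  ultimately show ?thesis by blast
qed

text \<open>Modulo the localized ideal, all monomials of one weight are multiples of a single
  \<open>z\<close>, the factor being their value at \<open>p\<close>. The component of
  \<open>f\<close> of that weight is thus its own value at \<open>p\<close> times \<open>z\<close>,
  which is zero.\<close>

theorem vanishing_on_orbit_localization:
  assumes f: "f \<in> forms V d" and van: "\<forall>x\<in>torus_orbit n m A. poly_eval f x = 0" and BV: "B \<in> V"
  shows "f \<in> localization V B J"
proof (cases "B \<in> bases")
  case False
  note L = poly_ideal_localization[OF J BV]
  \<comment> \<open>The chart is empty here, so the localized ideal contains 1.\<close>
  have "poly_var B ^ 1 * 1 \<in> localization V B J" using nonbasis_localization[OF BV BV False] by simp
  then have "1 \<in> localization V B J" by (rule localization_cancel[rotated]) simp
  from poly_idealD(4)[OF L forms_polys[OF f] this] show ?thesis by simp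
next
  case B: True
  note L = poly_ideal_localization[OF J BV]
  let ?L = "localization V B J" and ?k = "Poly_Mapping.keys f" and ?c = "Poly_Mapping.lookup f"
  interpret exchange_system bases B by (rule exchange_bases[OF B])
  have keys: "Poly_Mapping.keys u \<subseteq> V" and deg: "monom_degree u = d" if "u \<in> ?k" for u
    using f that by (auto simp: forms_iff)
  have "(\<Sum>u | u \<in> ?k \<and> weight u = w. Poly_Mapping.single u (?c u)) \<in> ?L" for w
  proof -
    let ?U = "{u. u \<in> ?k \<and> weight u = w}"
    have "\<exists>z\<in>polys V. \<forall>u\<in>?U. Poly_Mapping.single u 1 - poly_const (value_at_p u) * z \<in> ?L"
    proof (cases "\<exists>u\<in>?U. Poly_Mapping.keys u \<subseteq> bases")
      case False
      then have "Poly_Mapping.single u 1 - poly_const (value_at_p u) * 0 \<in> ?L" if "u \<in> ?U" for u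
        using monomial_localization[OF B keys, of u] that by auto
      then show ?thesis using polys_0 by blast
    next
      case True
      then obtain u0 where u0: "u0 \<in> ?U" "Poly_Mapping.keys u0 \<subseteq> bases" by blast
      let ?z = "normalized_monom (mset_of_monom u0)"
      have "Poly_Mapping.single u 1 - poly_const (value_at_p u) * ?z \<in> ?L" if u: "u \<in> ?U" for u
      proof -
        consider "Poly_Mapping.keys u \<subseteq> bases"
            "Poly_Mapping.single u 1 = poly_const (value_at_p u) * normalized_monom (mset_of_monom u)"
          | "value_at_p u = 0" "Poly_Mapping.single u 1 \<in> ?L"
          using monomial_localization[OF B keys, of u] u by auto
        then show ?thesis
        proof cases
          case 1
          have "swap_equiv bases B (mset_of_monom u) (mset_of_monom u0)"
            using 1(1) u u0 deg[of u] deg[of u0]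
            by (intro swap_equiv_if_ground_eq)
              (auto simp: set_mset_of_monom size_mset_of_monom weight_def)
          from poly_idealD(4)[OF L polys_const swap_equiv_localization[OF this B], of "value_at_p u"]
          show ?thesis unfolding 1(2) by (simp add: right_diff_distrib)
        qed simp
      qed
      then show ?thesis using normalized_monom_polys by blast
    qed
    then obtain z where z: "z \<in> polys V"
      "\<And>u. u \<in> ?U \<Longrightarrow> Poly_Mapping.single u 1 - poly_const (value_at_p u) * z \<in> ?L" by blast
    have "(\<Sum>u\<in>?U. poly_const (?c u) * (Poly_Mapping.single u 1 - poly_const (value_at_p u) * z)) \<in> ?L"
      by (intro poly_ideal_sum[OF L] poly_idealD(4)[OF L] z polys_const)
    also have "(\<Sum>u\<in>?U. poly_const (?c u) * (Poly_Mapping.single u 1 - poly_const (value_at_p u) * z))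
        = (\<Sum>u\<in>?U. Poly_Mapping.single u (?c u)) - poly_const (\<Sum>u\<in>?U. ?c u * value_at_p u) * z"
    proof -
      have "poly_const (?c u) * (Poly_Mapping.single u 1 - poly_const (value_at_p u) * z)
        = Poly_Mapping.single u (?c u) - poly_const (?c u * value_at_p u) * z" for u
        by (simp add: right_diff_distrib poly_const_mult mult.assoc) (simp add: poly_const_def mult_single)
      then show ?thesis by (simp only: sum_subtractf poly_const_sum sum_distrib_right)
    qed
    also have "\<dots> = (\<Sum>u\<in>?U. Poly_Mapping.single u (?c u))"
      using weight_component_value[OF forms_polys[OF f] van, of w] by simp
    finally show ?thesis .
  qed
  then have "(\<Sum>w\<in>weight ` ?k. \<Sum>u | u \<in> ?k \<and> weight u = w. Poly_Mapping.single u (?c u)) \<in> ?L"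
    by (rule poly_ideal_sum[OF L])
  also have "(\<Sum>w\<in>weight ` ?k. \<Sum>u | u \<in> ?k \<and> weight u = w. Poly_Mapping.single u (?c u))
      = (\<Sum>u\<in>?k. Poly_Mapping.single u (?c u))"
    by (intro sum.group) auto
  finally show ?thesis by (simp flip: poly_mapping_sum_single)
qed

end


section \<open>Forms vanishing on the sub-Grassmannian\<close>

lemma nsets_exchange:
  assumes "K \<in> nsets S n" "b \<in> K" "c \<in> S - K"
  shows "insert c (K - {b}) \<in> nsets S n"
proof -
  have K: "finite K" "card K = n" "K \<subseteq> S" using assms by (auto simp: nsets_iff)
  have "card (insert c (K - {b})) = Suc (card (K - {b}))"
    using K assms by (intro card_insert_disjoint) auto
  also have "\<dots> = card K" using K(1) assms(2) by (rule card_Suc_Diff1)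
  finally show ?thesis using K assms by (auto simp: nsets_iff)
qed

text \<open>The Pluecker relation of \<open>I\<close> with \<open>B\<close> writes the product of
  their coordinates through coordinates closer to \<open>B\<close> and neighbours of
  \<open>B\<close>; induction on the distance eliminates all other coordinates. \<open>J\<close> is
  left open because it will be generated by the quadrics vanishing on \<open>G\<^sub>e\<close>,
  among them the Pluecker relations.\<close>

lemma pluecker_chart:
  assumes B: "B \<in> nsets {..<m} n" and J: "poly_ideal (nsets {..<m} n) J"
    and quadrics: "\<And>q. q \<in> forms (nsets {..<m} n) 2 \<Longrightarrow>
      \<forall>A\<in>carrier_mat m n. poly_eval q (plucker n m A) = 0 \<Longrightarrow> q \<in> J"
    and h: "h \<in> polys (nsets {..<m} n)"
  shows "\<exists>N. \<exists>g\<in>polys (insert B {insert c (B - {b}) | b c. b \<in> B \<and> c \<in> {..<m} - B}). poly_var B ^ N * h - g \<in> J"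
proof -
  let ?V = "nsets {..<m} n"
  let ?W = "insert B {insert c (B - {b}) | b c. b \<in> B \<and> c \<in> {..<m} - B}"
  have finB: "finite B" "card B = n" "B \<subseteq> {..<m}" using B by (auto simp: nsets_iff)
  have WV: "?W \<subseteq> ?V" using B nsets_exchange[OF B] by blast
  \<comment> \<open>The elements with the desired property form an algebra closed under division by
    the coordinate at \<open>B\<close>, so only the variables remain to be treated.\<close>
  define H where "H h \<longleftrightarrow> h \<in> polys ?V \<and> (\<exists>N. \<exists>g\<in>polys ?W. poly_var B ^ N * h - g \<in> J)" for h
  have pw: "poly_var B ^ N \<in> polys ?W" for N by (intro polys_power polys_var) simp
  have HI: "H h" if "h \<in> polys ?V" "g \<in> polys ?W" "poly_var B ^ N * h - g \<in> J" for h g N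
    using that unfolding H_def by blast
  have HW: "H h" if "h \<in> polys ?W" for h
    using that poly_idealD(2)[OF J] polys_mono[OF WV] by (intro HI[of h h 0]) auto
  have HJ: "H h" if "h \<in> J" for h
    using that poly_idealD(1)[OF J] by (intro HI[of h 0 0]) auto
  have Hadd: "H (h1 + h2)" and Hmult: "H (h1 * h2)" if "H h1" "H h2" for h1 h2
  proof -
    obtain N1 g1 where 1: "h1 \<in> polys ?V" "g1 \<in> polys ?W" "poly_var B ^ N1 * h1 - g1 \<in> J"
      using \<open>H h1\<close> by (auto simp: H_def)
    obtain N2 g2 where 2: "h2 \<in> polys ?V" "g2 \<in> polys ?W" "poly_var B ^ N2 * h2 - g2 \<in> J"
      using \<open>H h2\<close> by (auto simp: H_def)
    let ?a = "poly_var B ^ N1" and ?b = "poly_var B ^ N2"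
    note V = polys_mono[OF WV]
    have "?b * (?a * h1 - g1) + ?a * (?b * h2 - g2) \<in> J"
      by (intro poly_idealD(3)[OF J] poly_idealD(4)[OF J] V[OF pw] 1 2)
    then have "poly_var B ^ (N1 + N2) * (h1 + h2) - (?b * g1 + ?a * g2) \<in> J"
      by (simp add: power_add algebra_simps)
    then show "H (h1 + h2)"
      by (rule HI[OF polys_add[OF 1(1) 2(1)] polys_add[OF polys_mult[OF pw 1(2)] polys_mult[OF pw 2(2)]]])
    have "(?b * h2) * (?a * h1 - g1) + g1 * (?b * h2 - g2) \<in> J"
      by (intro poly_idealD(3)[OF J] poly_idealD(4)[OF J] polys_mult V[OF pw] V 1 2)
    then have "poly_var B ^ (N1 + N2) * (h1 * h2) - g1 * g2 \<in> J"
      by (simp add: power_add algebra_simps)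
    then show "H (h1 * h2)"
      by (rule HI[OF polys_mult[OF 1(1) 2(1)] polys_mult[OF 1(2) 2(2)]])
  qed
  have Hsum: "H (\<Sum>i\<in>S. f i)" if "\<And>i. i \<in> S \<Longrightarrow> H (f i)" for f :: "nat \<Rightarrow> nat set cpoly" and S
    using that by (induction S rule: infinite_finite_induct) (auto intro: Hadd HW)
  have Hcancel: "H h" if Bh: "H (poly_var B * h)" and h: "h \<in> polys ?V" for h
  proof -
    obtain N g where "g \<in> polys ?W" "poly_var B ^ N * (poly_var B * h) - g \<in> J"
      using Bh unfolding H_def by blast
    then show ?thesis using h by (intro HI[of h g "Suc N"]) (auto simp: ac_simps)
  qed
  have Hvar: "H (poly_var I)" if "I \<in> ?V" for I
    using that
  proof (induction "card (I - B)" arbitrary: I rule: less_induct)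
    case less
    have I: "finite I" "card I = n" "I \<subseteq> {..<m}" using less.prems by (auto simp: nsets_iff)
    show ?case
    proof (cases "I - B = {}")
      case True
      then have "I = B" using I finB by (intro card_subset_eq) auto
      then show ?thesis by (intro HW polys_var) simp
    next
      case False
      then obtain i where i: "i \<in> I - B" by blast
      obtain \<eta> where \<eta>: "\<forall>A\<in>carrier_mat m n. plucker n m A I * plucker n m A B
        = (\<Sum>b\<in>B - I. \<eta> b * (plucker n m A (insert b (I - {i})) * plucker n m A (insert i (B - {b}))))"
        using plucker_exchange[OF less.prems B i] by blast
      let ?t = "\<lambda>b. poly_const (\<eta> b) * (poly_var (insert b (I - {i})) * poly_var (insert i (B - {b})))"
      let ?q = "poly_var B * poly_var I - (\<Sum>b\<in>B - I. ?t b)"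
      have V1: "insert b (I - {i}) \<in> ?V" and V2: "insert i (B - {b}) \<in> ?V" if "b \<in> B - I" for b
        using that i nsets_exchange[OF less.prems, of i b] nsets_exchange[OF B, of b i] finB I by auto
      have two: "poly_var K * poly_var L \<in> forms ?V 2" if "K \<in> ?V" "L \<in> ?V" for K L
        using forms_mult[OF forms_var[OF that(1)] forms_var[OF that(2)]] by (simp add: numeral_2_eq_2)
      have "?q \<in> J"
      proof (rule quadrics)
        show "?q \<in> forms ?V 2"
          by (intro forms_diff forms_sum forms_const_mult two B less.prems V1 V2)
        show "\<forall>A\<in>carrier_mat m n. poly_eval ?q (plucker n m A) = 0"
          using \<eta> by (simp add: eval.subst_simps mult.commute[of "plucker n m _ B"])
      qed
      then have Hq: "H ?q" by (rule HJ)
      have "H (?t b)" if b: "b \<in> B - I" for b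
      proof -
        have "insert b (I - {i}) - B = (I - B) - {i}" using b by auto
        then have "card (insert b (I - {i}) - B) < card (I - B)"
          using i I by (metis card_Diff1_less finite_Diff)
        then have "H (poly_var (insert b (I - {i})))" using V1[OF b] by (rule less.hyps)
        moreover have "H (poly_var (insert i (B - {b})))"
          using b i I by (intro HW polys_var) blast
        ultimately have "H (poly_var (insert b (I - {i})) * poly_var (insert i (B - {b})))" by (rule Hmult)
        then show ?thesis by (rule Hmult[OF HW[OF polys_const]])
      qed
      then have "H (\<Sum>b\<in>B - I. ?t b)" by (rule Hsum)
      from Hadd[OF Hq this] have "H (poly_var B * poly_var I)" by simp
      then show ?thesis using polys_var[OF less.prems] by (rule Hcancel)
    qed
  qed
  have "H h" using h
    by (induction rule: polys_induct) (auto intro: HW Hvar Hadd Hmult)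
  then show ?thesis by (auto simp: H_def)
qed

text \<open>\<open>K\<close> names a chart of the Pluecker space of \<open>Gr(k, m - 1)\<close>, and
  \<open>B\<close> below the chart of that of \<open>Gr(k + 1, m)\<close> which restricts to it.
  \<open>J'\<close> stands for the ideal of quadrics to be localized there.\<close>

locale wedge_chart =
  fixes m k :: nat and K :: "nat set" and J' :: "nat set cpoly set"
  assumes m: "0 < m" and K: "K \<in> nsets {..<m - 1} k" and J': "poly_ideal (nsets {..<m - 1} k) J'"
begin

abbreviation V where "V \<equiv> nsets {..<m} (Suc k)"
abbreviation V' where "V' \<equiv> nsets {..<m - 1} k"
abbreviation \<phi> :: "nat set cpoly \<Rightarrow> nat set cpoly" where "\<phi> \<equiv> poly_subst poly_const (wedge_e m)"

definition B where "B = insert (m - 1) K"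

lemma K_simps: "finite K" "card K = k" "K \<subseteq> {..<m - 1}" "m - 1 \<notin> K"
  using K by (auto simp: nsets_iff)

lemma B_V: "B \<in> V"
  using K_simps m by (auto simp: B_def nsets_iff)

text \<open>All terms other than the one at \<open>m - 1\<close> have an index containing
  \<open>m - 1\<close> and are absent.\<close>

lemma wedge_e_last:
  assumes "m - 1 \<in> I"
  shows "wedge_e m I = poly_const ((- 1) ^ card {l \<in> I. l < m - 1}) * poly_var (I - {m - 1})"
proof -
  have "{i. i \<in> I \<and> m - 1 \<notin> I - {i}} = {m - 1}" using assms by auto
  then show ?thesis by (simp add: wedge_e_def poly_const_power poly_const_uminus)
qed

lemma wedge_e_B: "wedge_e m B = poly_const ((- 1) ^ card {l \<in> B. l < m - 1}) * poly_var K"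
  using wedge_e_last[of B] K_simps(4) by (simp add: B_def)

text \<open>Since \<open>\<phi>\<close> sends the coordinate at \<open>B\<close> to that at
  \<open>K\<close> up to sign, denominators of the larger space become denominators of the smaller
  one.\<close>

lemma localization_if_wedge:
  assumes f: "\<phi> f \<in> polys V'" and "\<phi> (poly_var B ^ N * f) \<in> J'"
  shows "\<phi> f \<in> localization V' K J'"
proof -
  let ?\<epsilon> = "((- 1) ^ card {l \<in> B. l < m - 1}) ^ N :: complex"
  have "?\<epsilon> * ?\<epsilon> = 1" by (simp flip: power_mult_distrib)
  moreover have "\<phi> (poly_var B ^ N * f) = poly_const ?\<epsilon> * (poly_var K ^ N * \<phi> f)"
    by (simp add: subst.subst_simps wedge_e_B power_mult_distrib poly_const_power ac_simps)
  ultimately have eq: "poly_const ?\<epsilon> * \<phi> (poly_var B ^ N * f) = poly_var K ^ N * \<phi> f"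
    by (simp flip: mult.assoc poly_const_mult)
  have "poly_var K ^ N * \<phi> f \<in> J'"
    using poly_idealD(4)[OF J' polys_const assms(2), of ?\<epsilon>] unfolding eq .
  then show ?thesis using f by (auto simp: localization_def)
qed

end

lemma wedge_e_forms:
  assumes "I \<in> nsets {..<m} (Suc k)"
  shows "wedge_e m I \<in> forms (nsets {..<m - 1} k) 1"
  unfolding wedge_e_def
proof (rule forms_sum)
  fix i assume i: "i \<in> {i. i \<in> I \<and> m - 1 \<notin> I - {i}}"
  have I: "I \<subseteq> {..<m}" "finite I" "card I = Suc k" using assms by (auto simp: nsets_iff)
  have "j < m - 1" if "j \<in> I - {i}" for j
  proof -
    have "j < m" "j \<noteq> m - 1" using that I(1) i by auto
    then show ?thesis by linarith
  qed
  then have "I - {i} \<in> nsets {..<m - 1} k" using I i by (auto simp: nsets_iff)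
  then have "poly_const ((- 1) ^ card {k \<in> I. k < i}) * poly_var (I - {i}) \<in> forms (nsets {..<m - 1} k) 1"
    by (intro forms_const_mult forms_var)
  then show "(- 1) ^ card {k \<in> I. k < i} * poly_var (I - {i}) \<in> forms (nsets {..<m - 1} k) 1"
    by (simp add: poly_const_power poly_const_uminus)
qed

lemmas wedge_e_polys = forms_polys[OF wedge_e_forms]

context wedge_chart begin

lemma \<phi>_polys: "f \<in> polys V \<Longrightarrow> \<phi> f \<in> polys V'"
  by (rule poly_subst_in_polys[OF _ wedge_e_polys])

lemma \<phi>_ideal: "poly_ideal V {f \<in> polys V. \<phi> f \<in> J'}"
  by (rule poly_ideal_subst_vimage[OF J' wedge_e_polys])

text \<open>Modulo the Pluecker relations a form becomes, in the chart of \<open>B\<close>, a polynomial in the coordinates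
  at \<open>B\<close> and its neighbours. Restricted to \<open>G\<^sub>e\<close> these become free coordinates, so that a polynomial
  in them vanishes as soon as its values on \<open>G\<^sub>e\<close> do.\<close>

lemma vanishing_on_sub_grassmannian_localization:
  assumes J': "\<And>q. q \<in> forms V 2 \<Longrightarrow> \<forall>x\<in>sub_grassmannian (Suc k) m. poly_eval q x = 0 \<Longrightarrow> \<phi> q \<in> J'"
    and f: "f \<in> polys V" "\<forall>x\<in>sub_grassmannian (Suc k) m. poly_eval f x = 0"
  shows "\<phi> f \<in> localization V' K J'"
proof -
  let ?G = "sub_grassmannian (Suc k) m"
  define Q where "Q = {q \<in> forms V 2. \<forall>x\<in>?G. poly_eval q x = 0}"
  define J where "J = Idl\<^bsub>poly_ring V\<^esub> Q"
  define W where "W = insert B {insert c (B - {b}) | b c. b \<in> B \<and> c \<in> {..<m} - B}"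
  define W' where "W' = insert K {insert c (K - {b}) | b c. b \<in> K \<and> c \<in> {..<m - 1} - K}"
  have Q: "Q \<subseteq> polys V" by (auto simp: Q_def dest: forms_polys)
  have J: "poly_ideal V J" unfolding J_def using Q by (rule poly_ideal_genideal)
  have QJ: "q \<in> J" if "q \<in> Q" for q unfolding J_def using Q that by (rule genideal_self_poly)
  \<comment> \<open>Quadrics vanishing on the whole Grassmannian vanish on \<open>G\<^sub>e\<close>,
    so \<open>pluecker_chart\<close> applies to \<open>J\<close>.\<close>
  obtain N g where g: "g \<in> polys W" "poly_var B ^ N * f - g \<in> J"
  proof (rule exE[OF pluecker_chart[OF B_V J _ f(1), folded W_def]])
    fix q assume "q \<in> forms V 2" "\<forall>A\<in>carrier_mat m (Suc k). poly_eval q (plucker (Suc k) m A) = 0"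
    then show "q \<in> J" by (intro QJ) (auto simp: Q_def sub_grassmannian_def)
  qed blast
  have WV: "W \<subseteq> V"
    using B_V nsets_exchange[OF B_V] unfolding W_def by blast
  have "J \<subseteq> {f \<in> polys V. \<forall>x\<in>?G. poly_eval f x = 0}"
    unfolding J_def by (rule genideal_minimal_poly[OF poly_ideal_eval]) (auto simp: Q_def dest: forms_polys)
  then have van: "poly_eval g x = 0" if "x \<in> ?G" for x
    using g(2) that f(2) by (auto simp: eval.subst_simps)
  \<comment> \<open>Exchanging \<open>m - 1\<close> for \<open>c\<close> gives a combination of the
    coordinates at \<open>K\<close> and its neighbours; every other exchange, and \<open>B\<close>
    itself, gives a single such coordinate up to sign.\<close>
  have wW: "wedge_e m I \<in> polys W'" if "I \<in> W" for I
  proof -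
    from that consider "I = B" | b c where "b \<in> B" "c \<in> {..<m} - B" "I = insert c (B - {b})" "b = m - 1"
      | b c where "b \<in> K" "c \<in> {..<m} - B" "I = insert c (B - {b})" "b \<noteq> m - 1"
      by (auto simp: W_def B_def)
    then show ?thesis
    proof cases
      case 1
      then show ?thesis unfolding \<open>I = B\<close> wedge_e_B by (intro polys_mult polys_const polys_var) (simp add: W'_def)
    next
      case (2 b c)
      have c: "c \<in> {..<m - 1} - K" using 2(2) by (auto simp: B_def)
      have I: "I = insert c K" using 2 K_simps(4) by (auto simp: B_def)
      have "I - {i} \<in> W'" if "i \<in> I" for i
      proof (cases "i = c")
        case True
        then have "I - {i} = K" using I c by auto
        then show ?thesis by (simp add: W'_def)
      next
        case False
        then have "i \<in> K" "I - {i} = insert c (K - {i})" using that I by auto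
        then show ?thesis using c by (auto simp: W'_def)
      qed
      then have "(- 1) ^ j * poly_var (I - {i}) \<in> polys W'" if "i \<in> I" for i j
        using that by (intro polys_mult polys_power polys_uminus polys_1 polys_var)
      then show ?thesis unfolding wedge_e_def by (intro polys_sum) auto
    next
      case (3 b c)
      then have "m - 1 \<in> I" "I - {m - 1} = insert c (K - {b})" "c \<in> {..<m - 1} - K"
        using K_simps(4) by (auto simp: B_def)
      then show ?thesis unfolding wedge_e_last[OF \<open>m - 1 \<in> I\<close>] using 3(1)
        by (intro polys_mult polys_const polys_var) (auto simp: W'_def)
    qed
  qed
  \<comment> \<open>This is an identity of polynomials, not only a congruence modulo
    \<open>J'\<close>, because no relation holds between the coordinates in \<open>W'\<close> on
    \<open>G\<^sub>e\<close>.\<close>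
  have "\<phi> g = 0"
  proof (rule poly_eq_0_if_eval_eq_0)
    have "W' \<subseteq> Pow {..<m}" using K_simps m by (auto simp: W'_def)
    then show "finite W'" by (rule finite_subset) simp
    show gW: "\<phi> g \<in> polys W'" using g(1) wW by (rule poly_subst_in_polys)
    fix \<tau> :: "nat set \<Rightarrow> complex" assume "\<forall>J. \<tau> J \<noteq> 0"
    from sub_grassmannian_free_coordinates[OF K m this] obtain x \<omega> where x: "x \<in> ?G"
      "\<forall>I\<in>V. x I = poly_eval (wedge_e m I) \<omega>" "\<omega> K = \<tau> K"
      "\<forall>b\<in>K. \<forall>c\<in>{..<m - 1} - K. \<omega> (insert c (K - {b})) = \<tau> (insert c (K - {b}))" by blast
    \<comment> \<open>\<open>\<tau>\<close> need not be a Pluecker vector, but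
      \<open>\<phi> g\<close> involves only the coordinates in \<open>W'\<close>, where
      \<open>\<tau>\<close> agrees with the Pluecker vector \<open>\<omega>\<close>.\<close>
    have "poly_eval (\<phi> g) \<tau> = poly_eval (\<phi> g) \<omega>"
      using gW by (rule eval_cong) (use x in \<open>auto simp: W'_def\<close>)
    also have "\<dots> = poly_eval g (\<lambda>I. poly_eval (wedge_e m I) \<omega>)" by (rule eval_subst)
    also have "\<dots> = poly_eval g x"
      by (rule eval_cong[OF polys_mono[OF WV g(1)]]) (use x in auto)
    also have "\<dots> = 0" using van x by blast
    finally show "poly_eval (\<phi> g) \<tau> = 0" .
  qed
  moreover have "\<phi> (poly_var B ^ N * f - g) \<in> J'"
  proof -
    have "J \<subseteq> {f \<in> polys V. \<phi> f \<in> J'}"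
      unfolding J_def using assms(1) forms_polys by (intro genideal_minimal_poly[OF \<phi>_ideal]) (auto simp: Q_def)
    then show ?thesis using g(2) by auto
  qed
  ultimately have "\<phi> (poly_var B ^ N * f) \<in> J'" by (simp add: subst.subst_diff)
  then show ?thesis using \<phi>_polys[OF f(1)] by (rule localization_if_wedge[rotated])
qed

end

section \<open>Sums of ideals, Zariski closures and the conclusion\<close>

lemma set_add_poly_ring: "X <+>\<^bsub>poly_ring V\<^esub> Y = {f + g | f g. f \<in> X \<and> g \<in> Y}"
  by (auto simp: set_add_def')

lemma vanishing_forms_polys: "vanishing_forms V X \<subseteq> polys V"
  by (auto simp: vanishing_forms_def dest: forms_polys)

text \<open>The hypothesis keeps \<open>X\<close> inside its closure, which contains no zero
  vector.\<close>

lemma vanishing_forms_closure: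
  assumes "X \<subseteq> projective_points V"
  shows "vanishing_forms V (zariski_closure V X) = vanishing_forms V X"
  using assms by (auto simp: zariski_closure_def vanishing_forms_def)

lemma zariski_closure_eq_empty:
  assumes "\<forall>x\<in>X. \<forall>v\<in>V. x v = 0"
  shows "zariski_closure V X = {}"
proof -
  have "x v = 0" if "x \<in> zariski_closure V X" "v \<in> V" for x v
  proof -
    have "poly_var v \<in> vanishing_forms V X"
      using assms forms_var[OF that(2)] that(2) by (auto simp: vanishing_forms_def simp del: One_nat_def)
    then show ?thesis using that(1) by (auto simp: zariski_closure_def)
  qed
  then show ?thesis unfolding zariski_closure_def projective_points_def by blast
qed

theorem proposition4p1:
  fixes n m :: nat and F :: "real mat"
  assumes "arrangement n m F"
    and "essential n F"
    and "connected_matroid {..<m} (linear_matroid n m F)"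
  shows "defined_by_quadrics (nsets {..<m - 1} (n - 1)) (hkt_ideal n m F)"
proof -
  define A where "A = map_mat complex_of_real F"
  define k where "k = n - 1"
  have n: "n = Suc k" and A: "A \<in> carrier_mat m n"
    using assms(1) by (auto simp: arrangement_def k_def A_def)
  let ?V = "nsets {..<m} n" and ?V' = "nsets {..<m - 1} k" and ?\<phi> = "poly_subst poly_const (wedge_e m)"
  let ?O = "torus_orbit n m A" and ?G = "sub_grassmannian n m"
  let ?I1 = "homogeneous_ideal ?V (zariski_closure ?V ?O)" and ?I2 = "homogeneous_ideal ?V ?G"
  define S where "S = ?\<phi> ` hkt_intersection_ideal n m A"
  let ?I = "Idl\<^bsub>poly_ring ?V'\<^esub> S"
  let ?J = "Idl\<^bsub>poly_ring ?V'\<^esub> (forms ?V' 2 \<inter> ?I)"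
  interpret torus_orbit_ideal n m A by standard (rule A)
  have hkt: "hkt_ideal n m F = ?I" by (simp add: hkt_ideal_def S_def A_def k_def)
  have I1: "poly_ideal ?V ?I1" and I2: "poly_ideal ?V ?I2"
    unfolding homogeneous_ideal_def by (intro poly_ideal_genideal vanishing_forms_polys)+
  have S_eq: "S = {?\<phi> (f + g) | f g. f \<in> ?I1 \<and> g \<in> ?I2}"
    by (auto simp: S_def hkt_intersection_ideal_def Let_def set_add_poly_ring)
  have wedge: "wedge_e m I \<in> forms ?V' 1" if "I \<in> ?V" for I using that wedge_e_forms unfolding n by blast
  have \<phi>_polys: "?\<phi> f \<in> polys ?V'" if "f \<in> polys ?V" for f
    using that by (rule poly_subst_in_polys) (rule forms_polys[OF wedge])
  have SV: "S \<subseteq> polys ?V'"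
    using poly_idealD(1)[OF I1] poly_idealD(1)[OF I2] \<phi>_polys[OF polys_add] unfolding S_eq by blast
  have SI: "?\<phi> f \<in> ?I" if "f \<in> ?I1 \<or> f \<in> ?I2" for f
  proof -
    have "?\<phi> f \<in> S"
      using that poly_idealD(2)[OF I1] poly_idealD(2)[OF I2] unfolding S_eq
      by (metis (mono_tags, lifting) add.left_neutral add.right_neutral mem_Collect_eq)
    then show ?thesis by (rule genideal_self_poly[OF SV])
  qed
  have gen1: "f \<in> ?I1" if "f \<in> vanishing_forms ?V (zariski_closure ?V ?O)" for f
    using that unfolding homogeneous_ideal_def by (rule genideal_self_poly[OF vanishing_forms_polys])
  have gen2: "f \<in> ?I2" if "f \<in> vanishing_forms ?V ?G" for f
    using that unfolding homogeneous_ideal_def by (rule genideal_self_poly[OF vanishing_forms_polys])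
  \<comment> \<open>The substitution is linear, so quadrics of the larger space restrict to quadrics
    of the ideal.\<close>
  have QJ: "?\<phi> q \<in> ?J" if "q \<in> forms ?V 2" "q \<in> ?I1 \<or> q \<in> ?I2" for q
    using SI[OF that(2)] poly_subst_in_forms[OF that(1) wedge]
    by (intro genideal_self_poly) (auto dest: forms_polys)
  have fin: "finite ?V'" by (simp add: finite_imp_finite_nsets)
  have "defined_by_quadrics ?V' ?I"
  proof (rule defined_by_quadricsI[OF fin SV])
    fix s K assume s: "s \<in> S" and K: "K \<in> ?V'"
    have J': "poly_ideal ?V' ?J" by (rule poly_ideal_genideal) (auto dest: forms_polys)
    note L = poly_ideal_localization[OF J' K]
    show "s \<in> localization ?V' K ?J"
    proof (cases "\<exists>I\<in>?V. p I \<noteq> 0")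
      \<comment> \<open>If all maximal minors vanish, the orbit is the zero vector and its closure
        is empty. The constant 1 is then a vanishing form, the ideal is the whole ring, and the
        square of the coordinate at \<open>K\<close> is one of its quadrics.\<close>
      case False
      have "zariski_closure ?V ?O = {}"
        using False by (intro zariski_closure_eq_empty) (auto simp: torus_orbit_coordinates)
      then have "1 \<in> vanishing_forms ?V (zariski_closure ?V ?O)"
        by (auto simp: vanishing_forms_def intro: exI[of _ 0])
      then have "1 \<in> ?I" using SI[of 1] gen1 by auto
      then have "?I = polys ?V'"
        using poly_idealD(4)[OF poly_ideal_genideal[OF SV], of _ 1] poly_idealD(1)[OF poly_ideal_genideal[OF SV]] by auto
      moreover have "poly_var K ^ 2 \<in> forms ?V' 2" using forms_power[OF forms_var[OF K], of 2] by simp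
      ultimately have "poly_var K ^ 2 \<in> ?J"
        by (intro genideal_self_poly) (auto dest: forms_polys)
      then have "poly_var K ^ 2 * s \<in> ?J"
        using poly_idealD(4)[OF J', of s "poly_var K ^ 2"] s SV by (auto simp: mult.commute)
      then show ?thesis using s SV by (auto simp: localization_def)
    next
      case True
      then have "m > 0" using n by (cases m) (auto simp: nsets_iff)
      then interpret W: wedge_chart m k K ?J by unfold_locales (use K J' in auto)
      have OP: "?O \<subseteq> projective_points ?V"
      proof
        fix x assume "x \<in> ?O"
        then obtain t where t: "\<forall>i<m. t i \<noteq> 0" "x = (\<lambda>I. (\<Prod>i\<in>I. t i) * p I)"
          by (auto simp: torus_orbit_coordinates)
        obtain I where I: "I \<in> ?V" "p I \<noteq> 0" using True by blast
        then have "x I \<noteq> 0" using t by (auto simp: nsets_iff)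
        moreover have "x I = 0" if "I \<notin> ?V" for I using that t(2) by (simp add: plucker_def)
        ultimately show "x \<in> projective_points ?V" using I(1) unfolding projective_points_def by blast
      qed
      \<comment> \<open>Contracting the localized ideal to the larger ring gives an ideal, so both
        inclusions below only concern generators.\<close>
      let ?H = "{f \<in> polys ?V. ?\<phi> f \<in> localization ?V' K ?J}"
      have H: "poly_ideal ?V ?H" by (rule poly_ideal_subst_vimage[OF L]) (rule forms_polys[OF wedge])
      have "?I1 \<subseteq> ?H" unfolding homogeneous_ideal_def
      proof (rule genideal_minimal_poly[OF H], rule subsetI)
        fix f assume "f \<in> vanishing_forms ?V (zariski_closure ?V ?O)"
        then obtain d where f: "f \<in> forms ?V d" "\<forall>x\<in>?O. poly_eval f x = 0"
          unfolding vanishing_forms_closure[OF OP] by (auto simp: vanishing_forms_def)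
        \<comment> \<open>The orbit is examined in the chart of \<open>K \<union> {m - 1}\<close>;
          the denominator passes to \<open>K\<close> through
          \<open>W.localization_if_wedge\<close>.\<close>
        obtain N where N: "poly_var W.B ^ N * f \<in> J"
          using vanishing_on_orbit_localization[OF f] W.B_V by (auto simp: localization_def n)
        have "J \<subseteq> {f \<in> polys ?V. ?\<phi> f \<in> ?J}"
        proof (rule genideal_minimal_poly)
          show "poly_ideal ?V {f \<in> polys ?V. ?\<phi> f \<in> ?J}" using W.\<phi>_ideal by (simp add: n)
          show "quadrics \<subseteq> {f \<in> polys ?V. ?\<phi> f \<in> ?J}"
          proof
            fix q assume q: "q \<in> quadrics"
            then have "q \<in> vanishing_forms ?V (zariski_closure ?V ?O)"
              unfolding vanishing_forms_closure[OF OP] by (auto simp: quadrics_def vanishing_forms_def)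
            then show "q \<in> {f \<in> polys ?V. ?\<phi> f \<in> ?J}"
              using q QJ gen1 by (auto simp: quadrics_def dest: forms_polys)
          qed
        qed
        then have "?\<phi> (poly_var W.B ^ N * f) \<in> ?J" using N by blast
        then have "?\<phi> f \<in> localization ?V' K ?J"
          by (rule W.localization_if_wedge[rotated]) (rule \<phi>_polys[OF forms_polys[OF f(1)]])
        then show "f \<in> ?H" using forms_polys[OF f(1)] by simp
      qed
      moreover have "?I2 \<subseteq> ?H" unfolding homogeneous_ideal_def
      proof (rule genideal_minimal_poly[OF H], rule subsetI)
        fix f assume f: "f \<in> vanishing_forms ?V ?G"
        have "?\<phi> f \<in> localization ?V' K ?J"
        proof (rule W.vanishing_on_sub_grassmannian_localization)
          fix q assume "q \<in> forms (nsets {..<m} (Suc k)) 2" "\<forall>x\<in>sub_grassmannian (Suc k) m. poly_eval q x = 0"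
          then show "?\<phi> q \<in> ?J" by (intro QJ disjI2 gen2) (auto simp: n vanishing_forms_def)
        qed (use f in \<open>auto simp: n vanishing_forms_def dest: forms_polys\<close>)
        then show "f \<in> ?H" using f vanishing_forms_polys by auto
      qed
      ultimately show ?thesis
        using s poly_idealD(3)[OF L] by (auto simp: S_eq subst.subst_add)
    qed
  qed
  then show ?thesis by (simp add: hkt k_def)
qed

end
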